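(* Let $k_0,\dots,k_N$ be non-zero natural numbers and let $C\subseteq\mathbb{N}$ be a co-c.e. cohesive set. Then there is a computable linear order $\mathcal{M}$ of order-type $\omega$ such that the cohesive power $\Pi_C\mathcal{M}$ has order-type $\omega+\boldsymbol{\sigma}(\{\mathbf{k}_0,\dots,\mathbf{k}_N\})$.
   Context: A set $C\subseteq\mathbb{N}$ is cohesive if it is infinite and for every c.e. set $W$, either $C\setminus W$ or $C\cap W$ is finite; co-c.e. means $\mathbb{N}\setminus C$ is c.e. Write $X\subseteq^* Y$ if $X\setminus Y$ is finite. For a computable linear order $\mathcal{L}=(L,\prec_{\mathcal{L}})$, the cohesive power $\Pi_C\mathcal{L}$ has as elements the classes $[\varphi]$ of partial computable $\varphi\colon\mathbb{N}\to L$ with $C\subseteq^*\mathrm{dom}(\varphi)$ under $\varphi=_C\psi$ iff $C\subseteq^*\{x:\varphi(x)\downarrow=\psi(x)\downarrow\}$, ordered by $[\varphi]\prec[\psi]$ iff $C\subseteq^*\{x:\varphi(x)\downarrow,\psi(x)\downarrow,\varphi(x)\prec_{\mathcal{L}}\psi(x)\}$. $\mathbf{k}$ denotes the order-type of a $k$-element linear order. Shuffle: for a non-empty at most countable set $X$ of order-types, choose a coloring of $\mathbb{Q}$ with $|X|$ colors each of which is dense in $\mathbb{Q}$, assign distinct colors to members of $X$, and replace each rational by a copy of the order-type assigned to its color; the resulting order-type is $\boldsymbol{\sigma}(X)$ (independent of choices). *)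

theory Defs
  imports Complex_Main "HOL-Library.Nat_Bijection"
begin

text \<open>
  The partial computable functions on the natural numbers: Kleene's partial recursive
  functions, in the unary presentation. Several arguments are passed as one number through the
  pairing bijection \<^const>\<open>prod_encode\<close>, whose projections are therefore among the basic
  functions; \<^const>\<open>None\<close> stands for divergence. All operations are strict. In \<open>prim_rec\<close> the
  argument codes \<open>(a, k)\<close>, and the step function receives \<open>(a, (i, v))\<close> where \<open>v\<close> is the value
  at \<open>i\<close>. In \<open>minim\<close> the search for a zero diverges at the first argument where \<open>f\<close> does.
\<close>

inductive partial_computable :: "(nat \<rightharpoonup> nat) \<Rightarrow> bool" where
  zero: "partial_computable (\<lambda>_. Some 0)"
| succ: "partial_computable (\<lambda>n. Some (Suc n))"
| left: "partial_computable (\<lambda>n. Some (fst (prod_decode n)))"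
| right: "partial_computable (\<lambda>n. Some (snd (prod_decode n)))"
| pair: "partial_computable f \<Longrightarrow> partial_computable g \<Longrightarrow>
    partial_computable
      (\<lambda>n. Option.bind (f n) (\<lambda>a. Option.bind (g n) (\<lambda>b. Some (prod_encode (a, b)))))"
| comp: "partial_computable f \<Longrightarrow> partial_computable g \<Longrightarrow>
    partial_computable (\<lambda>n. Option.bind (f n) g)"
| prim_rec: "partial_computable f \<Longrightarrow> partial_computable g \<Longrightarrow>
    partial_computable
      (\<lambda>n. case prod_decode n of (a, k) \<Rightarrow>
        rec_nat (f a)
          (\<lambda>i r. Option.bind r (\<lambda>v. g (prod_encode (a, prod_encode (i, v))))) k)"
| minim: "partial_computable f \<Longrightarrow>
    partial_computable
      (\<lambda>a. if \<exists>n. f (prod_encode (a, n)) = Some 0 \<and> (\<forall>m<n. f (prod_encode (a, m)) \<noteq> None)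
           then Some (LEAST n. f (prod_encode (a, n)) = Some 0) else None)"

definition ce :: "nat set \<Rightarrow> bool" where
  "ce W \<longleftrightarrow> (\<exists>\<phi>. partial_computable \<phi> \<and> W = dom \<phi>)"

definition computable_set :: "nat set \<Rightarrow> bool" where
  "computable_set A \<longleftrightarrow> partial_computable (\<lambda>n. Some (if n \<in> A then 1 else 0))"

definition computable_rel :: "nat rel \<Rightarrow> bool" where
  "computable_rel R \<longleftrightarrow> computable_set (prod_encode ` R)"

definition almost_subset :: "'a set \<Rightarrow> 'a set \<Rightarrow> bool" (infix "\<subseteq>\<^sup>*" 50) where
  "X \<subseteq>\<^sup>* Y \<longleftrightarrow> finite (X - Y)"

definition cohesive :: "nat set \<Rightarrow> bool" where
  "cohesive C \<longleftrightarrow> infinite C \<and> (\<forall>W. ce W \<longrightarrow> finite (C - W) \<or> finite (C \<inter> W))"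

text \<open>
  Linear orders are given as a carrier together with a strict relation. The carrier is explicit
  because a one-element order has an empty strict relation. Order-types are compared through
  \<open>order_isomorphic\<close>, which only looks at the relations on the carriers.
\<close>

type_synonym 'a strict_order = "'a set \<times> 'a rel"

fun is_linear_order :: "'a strict_order \<Rightarrow> bool" where
  "is_linear_order (L, r) \<longleftrightarrow> r \<subseteq> L \<times> L \<and> strict_linear_order_on L r"

fun computable_linear_order :: "nat strict_order \<Rightarrow> bool" where
  "computable_linear_order (L, r) \<longleftrightarrow>
     L \<noteq> {} \<and> is_linear_order (L, r) \<and> computable_set L \<and> computable_rel r"

fun order_isomorphic :: "'a strict_order \<Rightarrow> 'b strict_order \<Rightarrow> bool" where
  "order_isomorphic (A, r) (B, s) \<longleftrightarrow>
     (\<exists>f. bij_betw f A B \<and> (\<forall>x\<in>A. \<forall>y\<in>A. (x, y) \<in> r \<longleftrightarrow> (f x, f y) \<in> s))"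

definition omega_order :: "nat strict_order" where
  "omega_order = (UNIV, {(x, y). x < y})"

definition finite_order :: "nat \<Rightarrow> nat strict_order" where
  "finite_order k = ({..<k}, {(x, y). x < y \<and> y < k})"

fun sum_order :: "'a strict_order \<Rightarrow> 'b strict_order \<Rightarrow> ('a + 'b) strict_order" where
  "sum_order (A, r) (B, s) =
     (A <+> B,
      {(Inl x, Inl y) | x y. (x, y) \<in> r} \<union> {(Inr x, Inr y) | x y. (x, y) \<in> s} \<union>
      {(Inl x, Inr y) | x y. x \<in> A \<and> y \<in> B})"

text \<open>
  A set \<open>X\<close> of order-types is represented by a set of pairwise non-isomorphic linear orders,
  and the colors are the members of \<open>X\<close> themselves. A dense coloring exists exactly when \<open>X\<close> is
  non-empty and at most countable; \<open>shuffle X\<close> is meant for such \<open>X\<close> only. Its order-type does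
  not depend on the coloring chosen.
\<close>

definition dense_coloring :: "'c set \<Rightarrow> (rat \<Rightarrow> 'c) \<Rightarrow> bool" where
  "dense_coloring X c \<longleftrightarrow>
     range c \<subseteq> X \<and> (\<forall>Y\<in>X. \<forall>a b. a < b \<longrightarrow> (\<exists>q. a < q \<and> q < b \<and> c q = Y))"

definition replace_rationals :: "(rat \<Rightarrow> 'a strict_order) \<Rightarrow> (rat \<times> 'a) strict_order" where
  "replace_rationals c =
     (SIGMA q:UNIV. fst (c q),
      {((p, x), (q, y)). x \<in> fst (c p) \<and> y \<in> fst (c q) \<and>
         (p < q \<or> p = q \<and> (x, y) \<in> snd (c p))})"

definition shuffle :: "'a strict_order set \<Rightarrow> (rat \<times> 'a) strict_order" where
  "shuffle X = replace_rationals (SOME c. dense_coloring X c)"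

text \<open>
  Elements of the cohesive power are equivalence classes of partial computable functions. Two
  classes are compared through representatives; the order does not depend on their choice.
\<close>

definition power_functions :: "nat set \<Rightarrow> nat set \<Rightarrow> (nat \<rightharpoonup> nat) set" where
  "power_functions C L = {\<phi>. partial_computable \<phi> \<and> ran \<phi> \<subseteq> L \<and> C \<subseteq>\<^sup>* dom \<phi>}"

definition power_eq :: "nat set \<Rightarrow> nat set \<Rightarrow> (nat \<rightharpoonup> nat) rel" where
  "power_eq C L = {(\<phi>, \<psi>). \<phi> \<in> power_functions C L \<and> \<psi> \<in> power_functions C L \<and>
     C \<subseteq>\<^sup>* {x. \<exists>u. \<phi> x = Some u \<and> \<psi> x = Some u}}"

fun cohesive_power :: "nat set \<Rightarrow> nat strict_order \<Rightarrow> (nat \<rightharpoonup> nat) set strict_order" where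
  "cohesive_power C (L, r) =
     (power_functions C L // power_eq C L,
      {(power_eq C L `` {\<phi>}, power_eq C L `` {\<psi>}) | \<phi> \<psi>.
         \<phi> \<in> power_functions C L \<and> \<psi> \<in> power_functions C L \<and>
         C \<subseteq>\<^sup>* {x. \<exists>u v. \<phi> x = Some u \<and> \<psi> x = Some v \<and> (u, v) \<in> r}})"

end

theory Submission
  imports Defs "HOL-Library.Countable_Set"
begin

text \<open>
  No universal function is needed: a c.e. set of rationals does the work of a priority construction.
  Cohesiveness makes every computable \<open>h\<close> that tends to infinity along \<open>C\<close> strictly increasing on
  almost all of \<open>C\<close>. Hence \<open>h n\<close> is at least the number of elements of \<open>C\<close> below \<open>n\<close>, up to a constant,
  and for every computable \<open>f\<close> and almost every \<open>n \<in> C\<close> the next element of \<open>C\<close> exceeds \<open>f n\<close>.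

  Let \<open>A\<close> be the set of the fractions \<open>a\<close> (identified with their codes, and colored by \<open>0, \<dots>, N\<close>) such
  that \<open>C\<close> has at most \<open>2 a\<close> elements up to the code of \<open>a\<close>. It is c.e. since \<open>C\<close> is co-c.e., and it has
  only finitely many elements below each bound, so it has order-type \<open>\<omega>\<close>. A computable function whose
  values are fractions tending to infinity along \<open>C\<close> takes its values in \<open>A\<close> almost everywhere on \<open>C\<close>.
  Therefore the fraction of a prescribed color with the least code between two non-standard elements of the
  cohesive power of \<open>A\<close> is again an element of the power, and the non-standard part is a dense colored
  order. Replacing the elements of \<open>A\<close> by finite blocks gives the result.
\<close>

subsection \<open>Total computable functions and decidable predicates\<close>

text \<open>Two demands on the set of fractions pull in opposite directions. Order-type \<omega>
  forces it to be sparse, yet the least code of a fraction with a prescribed color between two given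
  ones may be far larger than the argument \<open>n\<close> from which these were computed. The
  number of elements of \<open>C\<close> up to a code is a threshold that serves both demands. It is
  unbounded because \<open>C\<close> is infinite, and it hardly notices a computable jump from
  \<open>n\<close> to \<open>f n\<close>: for almost all \<open>n\<close> in \<open>C\<close> no
  element of \<open>C\<close> lies between them, so the threshold at \<open>f n\<close> exceeds the
  count below \<open>n\<close> by at most one. The integer part of the fraction dominates that count
  up to an additive constant. The standard part of the power is \<omega> for another reason: a
  computable function into the fractions that does not tend to infinity along \<open>C\<close> is
  bounded almost everywhere on \<open>C\<close>, hence takes finitely many values there, hence is
  constant there up to finitely many arguments. Offsets inside blocks become constant in the same
  way. Finally, \<open>C\<close> being co-c.e. lets total functions represent all elements of the
  power: a computation on \<open>n\<close> is awaited until it stops or \<open>n\<close> is seen to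
  leave \<open>C\<close>.\<close>

abbreviation pfst :: "nat \<Rightarrow> nat" where "pfst x \<equiv> fst (prod_decode x)"
abbreviation psnd :: "nat \<Rightarrow> nat" where "psnd x \<equiv> snd (prod_decode x)"
abbreviation pr :: "nat \<Rightarrow> nat \<Rightarrow> nat" where "pr a b \<equiv> prod_encode (a, b)"

definition computable :: "(nat \<Rightarrow> nat) \<Rightarrow> bool" where
  "computable f \<longleftrightarrow> partial_computable (\<lambda>n. Some (f n))"

definition decidable :: "(nat \<Rightarrow> bool) \<Rightarrow> bool" where
  "decidable P \<longleftrightarrow> computable (\<lambda>n. of_bool (P n))"

text \<open>The closure rules collected here carry an inner function in each argument place, so that
  \<open>intro cintros\<close> can follow the syntax of a term and no explicit composition is
  needed.\<close>

named_theorems cintros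

lemma computable_comp: "computable g \<Longrightarrow> computable f \<Longrightarrow> computable (\<lambda>n. g (f n))"
  unfolding computable_def using partial_computable.comp[of "\<lambda>n. Some (f n)" "\<lambda>n. Some (g n)"] by simp

lemma computable_pair [cintros]:
  "computable f \<Longrightarrow> computable g \<Longrightarrow> computable (\<lambda>n. pr (f n) (g n))"
  unfolding computable_def using partial_computable.pair[of "\<lambda>n. Some (f n)" "\<lambda>n. Some (g n)"] by simp

lemma computable_pfst [cintros]: "computable f \<Longrightarrow> computable (\<lambda>n. pfst (f n))"
  using computable_comp[of pfst f] partial_computable.left by (simp add: computable_def)

lemma computable_psnd [cintros]: "computable f \<Longrightarrow> computable (\<lambda>n. psnd (f n))"
  using computable_comp[of psnd f] partial_computable.right by (simp add: computable_def)

lemma computable_id [cintros]: "computable (\<lambda>n. n)"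
  using computable_pair[of pfst psnd] partial_computable.left partial_computable.right
  by (simp add: computable_def)

lemma computable_Suc [cintros]: "computable f \<Longrightarrow> computable (\<lambda>n. Suc (f n))"
  using computable_comp[of Suc f] partial_computable.succ by (simp add: computable_def)

lemma computable_const [cintros]: "computable (\<lambda>n. c)"
proof (induction c)
  case 0
  show ?case using partial_computable.zero by (simp add: computable_def)
qed (rule computable_Suc)

lemma computable_rec_nat [cintros]:
  assumes "computable b" "computable (\<lambda>x. g (pfst x) (pfst (psnd x)) (psnd (psnd x)))" "computable t"
  shows "computable (\<lambda>n. rec_nat (b n) (g n) (t n))"
proof -
  have eq: "rec_nat (Some c) (\<lambda>i r. Option.bind r (\<lambda>v. Some (g a i v))) m = Some (rec_nat c (g a) m)"
    for a c m by (induction m) auto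
  have "computable (\<lambda>x. rec_nat (b (pfst x)) (g (pfst x)) (psnd x))"
    using partial_computable.prim_rec[of "\<lambda>n. Some (b n)"
        "\<lambda>x. Some (g (pfst x) (pfst (psnd x)) (psnd (psnd x)))"] assms(1,2)
    by (simp add: computable_def case_prod_beta eq)
  \<comment> \<open>The recursion was built with independent parameter and depth; pairing
    \<open>n\<close> with \<open>t n\<close> sets the depth.\<close>
  from computable_comp[OF this computable_pair[OF computable_id assms(3)]] show ?thesis by simp
qed

lemma computable_add [cintros]:
  assumes "computable f" "computable g" shows "computable (\<lambda>n. f n + g n)"
proof -
  have "rec_nat a (\<lambda>i v. Suc v) m = a + m" for a m :: nat by (induction m) auto
  then show ?thesis
    using computable_rec_nat[of f "\<lambda>_ _ v. Suc v" g, OF assms(1) _ assms(2)]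
    by (simp add: computable_Suc computable_psnd computable_id)
qed

lemma computable_mult [cintros]:
  assumes "computable f" "computable g" shows "computable (\<lambda>n. f n * g n)"
proof -
  have eq: "rec_nat 0 (\<lambda>i v. v + a) m = a * m" for a m :: nat by (induction m) auto
  have "computable (\<lambda>n. rec_nat 0 (\<lambda>i v. v + f n) (g n))"
    by (intro cintros computable_comp[OF assms(1)] assms)
  then show ?thesis by (simp add: eq)
qed

lemma computable_power [cintros]:
  assumes "computable f" "computable g" shows "computable (\<lambda>n. f n ^ g n)"
proof -
  have eq: "rec_nat (Suc 0) (\<lambda>i v. v * a) m = a ^ m" for a m :: nat by (induction m) auto
  have "computable (\<lambda>n. rec_nat (Suc 0) (\<lambda>i v. v * f n) (g n))"
    by (intro cintros computable_comp[OF assms(1)] assms)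
  then show ?thesis by (simp add: eq)
qed

lemma computable_diff [cintros]:
  assumes "computable f" "computable g" shows "computable (\<lambda>n. f n - g n)"
proof -
  \<comment> \<open>The predecessor is a recursion that returns its index and forgets its value;
    truncated subtraction iterates it.\<close>
  have pred: "rec_nat 0 (\<lambda>i v. i) m = m - 1" for m :: nat by (induction m) auto
  have eq: "rec_nat a (\<lambda>i v. rec_nat 0 (\<lambda>i v. i) v) m = a - m" for a m :: nat
    by (induction m) (auto simp: pred)
  have "computable (\<lambda>n. rec_nat (f n) (\<lambda>i v. rec_nat 0 (\<lambda>i v. i) v) (g n))"
    by (intro cintros assms)
  then show ?thesis by (simp add: eq)
qed

lemma computable_sum [cintros]:
  assumes "computable t" "computable (\<lambda>x. f (pfst x) (psnd x))"
  shows "computable (\<lambda>n. \<Sum>i<t n. f n i)"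
proof -
  have eq: "rec_nat 0 (\<lambda>i v. v + h i) m = (\<Sum>i<m. h i)" for h m by (induction m) auto
  have "computable (\<lambda>x. pr (pfst x) (pfst (psnd x)))" by (intro cintros)
  from computable_comp[OF assms(2) this]
  have "computable (\<lambda>x. f (pfst x) (pfst (psnd x)))" by simp
  then have "computable (\<lambda>n. rec_nat 0 (\<lambda>i v. v + f n i) (t n))"
    by (intro cintros assms)
  then show ?thesis by (simp add: eq)
qed

section \<open>Decidable predicates and unbounded search\<close>

lemma decidable_comp: "decidable P \<Longrightarrow> computable f \<Longrightarrow> decidable (\<lambda>n. P (f n))"
  unfolding decidable_def by (rule computable_comp)

lemma computable_of_bool [cintros]: "decidable P \<Longrightarrow> computable (\<lambda>n. of_bool (P n))"
  unfolding decidable_def .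

lemma decidable_not [cintros]: "decidable P \<Longrightarrow> decidable (\<lambda>n. \<not> P n)"
proof -
  assume "decidable P"
  then have "computable (\<lambda>n. 1 - of_bool (P n))" by (intro cintros)
  moreover have "1 - of_bool b = (of_bool (\<not> b) :: nat)" for b by simp
  ultimately show ?thesis by (simp add: decidable_def)
qed

lemma decidable_conj [cintros]: "decidable P \<Longrightarrow> decidable Q \<Longrightarrow> decidable (\<lambda>n. P n \<and> Q n)"
  using computable_mult[of "\<lambda>n. of_bool (P n)" "\<lambda>n. of_bool (Q n)"]
  by (simp add: decidable_def of_bool_conj)

lemma decidable_disj [cintros]: "decidable P \<Longrightarrow> decidable Q \<Longrightarrow> decidable (\<lambda>n. P n \<or> Q n)"
  using decidable_not[of "\<lambda>n. \<not> P n \<and> \<not> Q n"] by (simp add: decidable_conj decidable_not)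

lemma decidable_imp [cintros]: "decidable P \<Longrightarrow> decidable Q \<Longrightarrow> decidable (\<lambda>n. P n \<longrightarrow> Q n)"
  unfolding imp_conv_disj by (intro cintros)

lemma decidable_less [cintros]:
  assumes "computable f" "computable g" shows "decidable (\<lambda>n. f n < g n)"
proof -
  have "computable (\<lambda>n. 1 - (1 - (g n - f n)))" by (intro cintros assms)
  moreover have "1 - (1 - (b - a)) = (of_bool (a < b) :: nat)" for a b :: nat by auto
  ultimately show ?thesis by (simp add: decidable_def)
qed

lemma decidable_le [cintros]:
  "computable f \<Longrightarrow> computable g \<Longrightarrow> decidable (\<lambda>n. f n \<le> g n)"
  unfolding not_less[symmetric] by (intro cintros)

lemma decidable_eq [cintros]:
  "computable f \<Longrightarrow> computable g \<Longrightarrow> decidable (\<lambda>n. f n = g n)"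
  unfolding eq_iff by (intro cintros)

lemma computable_if [cintros]:
  assumes "decidable P" "computable f" "computable g"
  shows "computable (\<lambda>n. if P n then f n else g n)"
proof -
  have "computable (\<lambda>n. of_bool (P n) * f n + (1 - of_bool (P n)) * g n)" by (intro cintros assms)
  moreover have "of_bool b * x + (1 - of_bool b) * y = (if b then x else y)" for b and x y :: nat by simp
  ultimately show ?thesis by simp
qed

lemma partial_computable_LEAST:
  assumes "decidable (\<lambda>x. P (pfst x) (psnd x))"
  shows "partial_computable (\<lambda>n. if \<exists>m. P n m then Some (LEAST m. P n m) else None)"
proof -
  \<comment> \<open>\<open>minim\<close> looks for a zero, hence the negation. The searched function
    is total, so the proviso of \<open>minim\<close> on earlier arguments holds trivially.\<close>
  have "partial_computable (\<lambda>x. Some (of_bool (\<not> P (pfst x) (psnd x))))"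
    using decidable_not[OF assms] by (simp add: decidable_def computable_def)
  from partial_computable.minim[OF this] show ?thesis by (simp cong: if_cong del: of_bool_not_iff)
qed

lemma computable_LEAST [cintros]:
  assumes "decidable (\<lambda>x. P (pfst x) (psnd x))" "\<And>n. \<exists>m. P n m"
  shows "computable (\<lambda>n. LEAST m. P n m)"
  using partial_computable_LEAST[OF assms(1)] assms(2) by (simp add: computable_def)

text \<open>A bounded quantifier is decided by counting the counterexamples.\<close>

lemma decidable_all_less [cintros]:
  assumes "computable t" "decidable (\<lambda>x. P (pfst x) (psnd x))"
  shows "decidable (\<lambda>n. \<forall>i<t n. P n i)"
proof -
  have "decidable (\<lambda>n. (\<Sum>i<t n. of_bool (\<not> P n i)) = (0::nat))"
    by (intro cintros assms)
  then show ?thesis by (rule back_subst[of decidable]) (auto simp: fun_eq_iff simp del: of_bool_not_iff)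
qed

lemma ce_Ex_decidable:
  assumes "decidable (\<lambda>x. P (pfst x) (psnd x))"
  shows "ce {n. \<exists>m. P n m}"
  unfolding ce_def using partial_computable_LEAST[OF assms] by (fastforce split: if_splits)

lemma decidable_imp_ce: "decidable P \<Longrightarrow> ce {n. P n}"
  using ce_Ex_decidable[of "\<lambda>n _. P n"] decidable_comp[of P pfst, OF _ computable_pfst[OF computable_id]]
  by simp

lemma computable_set_iff: "computable_set A \<longleftrightarrow> decidable (\<lambda>n. n \<in> A)"
  by (simp add: computable_set_def decidable_def computable_def of_bool_def)

lemma computable_rel_iff: "computable_rel R \<longleftrightarrow> decidable (\<lambda>x. (pfst x, psnd x) \<in> R)"
proof -
  have "x \<in> prod_encode ` R \<longleftrightarrow> (pfst x, psnd x) \<in> R" for x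
    by (metis image_iff prod.collapse prod_decode_inverse prod_encode_inverse)
  then show ?thesis by (simp add: computable_rel_def computable_set_iff)
qed

text \<open>Here \<open>f\<close> is arbitrary: a finite table is always computable. It will be
  applied to the block sizes \<open>k 0, ..., k N\<close>.\<close>

lemma computable_finite_support:
  "computable (\<lambda>n. if n \<le> N then f n else (0::nat))"
proof (induction N)
  case 0
  have "computable (\<lambda>n. if n = 0 then f 0 else 0)" by (intro cintros)
  then show ?case by (rule back_subst[of computable]) auto
next
  case (Suc N)
  have "computable (\<lambda>n. if n = Suc N then f (Suc N) else if n \<le> N then f n else 0)"
    by (intro cintros Suc)
  then show ?case by (rule back_subst[of computable]) auto
qed

subsection \<open>Computing in stages\<close>

text \<open>\<open>F n s = 0\<close> means that the computation of \<open>f n\<close> has not stopped by stage \<open>s\<close>.\<close>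

definition stages :: "(nat \<rightharpoonup> nat) \<Rightarrow> (nat \<Rightarrow> nat \<Rightarrow> nat) \<Rightarrow> bool" where
  "stages f F \<longleftrightarrow> computable (\<lambda>x. F (pfst x) (psnd x)) \<and>
     (\<forall>n s t v. s \<le> t \<longrightarrow> F n s = Suc v \<longrightarrow> F n t = Suc v) \<and>
     (\<forall>n v. f n = Some v \<longleftrightarrow> (\<exists>s. F n s = Suc v))"

lemma stages_mono: "stages f F \<Longrightarrow> F n s = Suc v \<Longrightarrow> s \<le> t \<Longrightarrow> F n t = Suc v"
  by (auto simp: stages_def)

lemma stages_SomeI: "stages f F \<Longrightarrow> F n s = Suc v \<Longrightarrow> f n = Some v"
  by (auto simp: stages_def)

lemma stages_SomeE: "stages f F \<Longrightarrow> f n = Some v \<Longrightarrow> \<exists>s. F n s = Suc v"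
  by (auto simp: stages_def)

lemma stages_computable:
  "stages f F \<Longrightarrow> computable f1 \<Longrightarrow> computable f2 \<Longrightarrow> computable (\<lambda>n. F (f1 n) (f2 n))"
  using computable_comp[of "\<lambda>x. F (pfst x) (psnd x)", OF _ computable_pair, of f1 f2]
  by (simp add: stages_def)

lemma stages_total: "computable f \<Longrightarrow> stages (\<lambda>n. Some (f n)) (\<lambda>n s. Suc (f n))"
  unfolding stages_def by (auto intro!: computable_Suc computable_comp[of f] computable_pfst computable_id)

lemma stages_pair:
  assumes F: "stages f F" and G: "stages g G"
  shows "stages (\<lambda>n. Option.bind (f n) (\<lambda>a. Option.bind (g n) (\<lambda>b. Some (pr a b))))
    (\<lambda>n s. if F n s = 0 \<or> G n s = 0 then 0 else Suc (pr (F n s - 1) (G n s - 1)))"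
    (is "stages ?f ?F")
  unfolding stages_def
proof (intro conjI allI impI)
  show "computable (\<lambda>x. ?F (pfst x) (psnd x))"
    by (intro cintros stages_computable[OF F] stages_computable[OF G])
  show "?F n t = Suc v" if "s \<le> t" "?F n s = Suc v" for n s t v
  proof -
    from that obtain a b where "F n s = Suc a" "G n s = Suc b" "v = pr a b"
      by (auto split: if_splits simp: gr0_conv_Suc)
    then show ?thesis using stages_mono[OF F _ that(1)] stages_mono[OF G _ that(1)] by simp
  qed
  show "?f n = Some v \<longleftrightarrow> (\<exists>s. ?F n s = Suc v)" for n v
  proof
    assume "?f n = Some v"
    then obtain a b where ab: "f n = Some a" "g n = Some b" "v = pr a b" by (auto simp: bind_eq_Some_conv)
    then obtain s t where "F n s = Suc a" "G n t = Suc b" using stages_SomeE[OF F] stages_SomeE[OF G] by blast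
    then have "F n (max s t) = Suc a" "G n (max s t) = Suc b"
      using stages_mono[OF F] stages_mono[OF G] by (meson max.cobounded1 max.cobounded2)+
    then show "\<exists>s. ?F n s = Suc v" using ab by (intro exI[of _ "max s t"]) simp
  next
    assume "\<exists>s. ?F n s = Suc v"
    then obtain s a b where "F n s = Suc a" "G n s = Suc b" "v = pr a b"
      by (auto split: if_splits simp: gr0_conv_Suc)
    then show "?f n = Some v" using stages_SomeI[OF F] stages_SomeI[OF G] by simp
  qed
qed

lemma stages_comp:
  assumes F: "stages f F" and G: "stages g G"
  shows "stages (\<lambda>n. Option.bind (f n) g) (\<lambda>n s. if F n s = 0 then 0 else G (F n s - 1) s)"
    (is "stages ?f ?F")
  unfolding stages_def
proof (intro conjI allI impI)
  show "computable (\<lambda>x. ?F (pfst x) (psnd x))"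
    by (intro cintros stages_computable[OF F] stages_computable[OF G])
  show "?F n t = Suc v" if "s \<le> t" "?F n s = Suc v" for n s t v
  proof -
    from that obtain a where "F n s = Suc a" "G a s = Suc v"
      by (auto split: if_splits simp: gr0_conv_Suc)
    then show ?thesis using stages_mono[OF F _ that(1)] stages_mono[OF G _ that(1)] by simp
  qed
  show "?f n = Some v \<longleftrightarrow> (\<exists>s. ?F n s = Suc v)" for n v
  proof
    assume "?f n = Some v"
    then obtain a where ab: "f n = Some a" "g a = Some v" by (auto simp: bind_eq_Some_conv)
    then obtain s t where "F n s = Suc a" "G a t = Suc v" using stages_SomeE[OF F] stages_SomeE[OF G] by blast
    then have "F n (max s t) = Suc a" "G a (max s t) = Suc v"
      using stages_mono[OF F] stages_mono[OF G] by (meson max.cobounded1 max.cobounded2)+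
    then show "\<exists>s. ?F n s = Suc v" using ab by (intro exI[of _ "max s t"]) simp
  next
    assume "\<exists>s. ?F n s = Suc v"
    then obtain s a where "F n s = Suc a" "G a s = Suc v"
      by (auto split: if_splits simp: gr0_conv_Suc)
    then show "?f n = Some v" using stages_SomeI[OF F] stages_SomeI[OF G] by simp
  qed
qed

text \<open>All calls are run with the same stage bound \<open>s\<close>, which turns the partial
  recursion into a total one; a value 0, meaning that some call is unfinished, propagates to the
  end.\<close>

lemma stages_prim_rec:
  assumes F: "stages f F" and G: "stages g G"
  shows "stages (\<lambda>n. case prod_decode n of (a, k) \<Rightarrow>
        rec_nat (f a) (\<lambda>i r. Option.bind r (\<lambda>v. g (pr a (pr i v)))) k)
    (\<lambda>n s. rec_nat (F (pfst n) s) (\<lambda>i r. if r = 0 then 0 else G (pr (pfst n) (pr i (r - 1))) s) (psnd n))"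
proof -
  define H where "H a s k = rec_nat (F a s) (\<lambda>i r. if r = 0 then 0 else G (pr a (pr i (r - 1))) s) k" for a s k
  define h where "h a k = rec_nat (f a) (\<lambda>i r. Option.bind r (\<lambda>v. g (pr a (pr i v)))) k" for a k
  have H_Suc: "H a s (Suc k) = (if H a s k = 0 then 0 else G (pr a (pr k (H a s k - 1))) s)" for a s k
    by (simp add: H_def)
  have h_Suc: "h a (Suc k) = Option.bind (h a k) (\<lambda>v. g (pr a (pr k v)))" for a k
    by (simp add: h_def)
  have mono: "s \<le> t \<Longrightarrow> H a s k = Suc v \<Longrightarrow> H a t k = Suc v" for a s t k v
  proof (induction k arbitrary: v)
    case 0
    then show ?case using stages_mono[OF F, of a s v t] by (simp add: H_def)
  next
    case (Suc k)
    then obtain w where w: "H a s k = Suc w" "G (pr a (pr k w)) s = Suc v"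
      by (auto simp: H_Suc gr0_conv_Suc split: if_splits)
    then show ?case using Suc.IH[OF Suc.prems(1) w(1)] stages_mono[OF G w(2) Suc.prems(1)]
      by (simp add: H_Suc)
  qed
  have lim: "h a k = Some v \<longleftrightarrow> (\<exists>s. H a s k = Suc v)" for a k v
  proof (induction k arbitrary: v)
    case 0
    then show ?case using F by (auto simp: h_def H_def stages_def)
  next
    case (Suc k)
    show ?case
    proof
      assume "h a (Suc k) = Some v"
      then obtain w where w: "h a k = Some w" "g (pr a (pr k w)) = Some v"
        by (auto simp: h_Suc bind_eq_Some_conv)
      then obtain s t where "H a s k = Suc w" "G (pr a (pr k w)) t = Suc v"
        using Suc.IH stages_SomeE[OF G] by blast
      then have "H a (max s t) k = Suc w" "G (pr a (pr k w)) (max s t) = Suc v"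
        using mono stages_mono[OF G] by (meson max.cobounded1 max.cobounded2)+
      then show "\<exists>s. H a s (Suc k) = Suc v"
        by (intro exI[of _ "max s t"]) (simp add: H_Suc)
    next
      assume "\<exists>s. H a s (Suc k) = Suc v"
      then obtain s w where w: "H a s k = Suc w" "G (pr a (pr k w)) s = Suc v"
        by (auto simp: H_Suc gr0_conv_Suc split: if_splits)
      then have "h a k = Some w" using Suc.IH by blast
      then show "h a (Suc k) = Some v" using stages_SomeI[OF G w(2)] by (simp add: h_Suc)
    qed
  qed
  have "computable (\<lambda>x. H (pfst (pfst x)) (psnd x) (psnd (pfst x)))"
    unfolding H_def by (intro cintros stages_computable[OF F] stages_computable[OF G])
  then show ?thesis using mono lim unfolding stages_def
    by (auto simp: case_prod_beta simp flip: H_def h_def)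
qed

text \<open>The search at stage \<open>s\<close> halts at the first \<open>m\<close> whose
  computation is unfinished (value 0) or has returned zero (value 1), whence
  \<open>F (pr a m) s \<le> 1\<close>; the alternative \<open>m \<ge> s\<close> makes it total. Only
  the second outcome counts as success, so no unfinished computation is skipped.\<close>

lemma stages_minim:
  assumes F: "stages f F"
  shows "stages (\<lambda>a. if \<exists>n. f (pr a n) = Some 0 \<and> (\<forall>m<n. f (pr a m) \<noteq> None)
           then Some (LEAST n. f (pr a n) = Some 0) else None)
    (\<lambda>a s. if (LEAST m. m \<ge> s \<or> F (pr a m) s \<le> 1) < s \<and>
        F (pr a (LEAST m. m \<ge> s \<or> F (pr a m) s \<le> 1)) s = 1
      then Suc (LEAST m. m \<ge> s \<or> F (pr a m) s \<le> 1) else 0)"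
    (is "stages ?f ?F")
proof -
  have F_eq: "?F a s = Suc v \<longleftrightarrow> v < s \<and> F (pr a v) s = 1 \<and> (\<forall>m<v. F (pr a m) s \<ge> 2)"
    (is "_ \<longleftrightarrow> ?R a s v") for a s v
  proof
    assume "?F a s = Suc v"
    then have v: "v = (LEAST m. m \<ge> s \<or> F (pr a m) s \<le> 1)" "v < s" "F (pr a v) s = 1"
      by (auto split: if_splits)
    have "\<not> (m \<ge> s \<or> F (pr a m) s \<le> 1)" if "m < v" for m
      using that unfolding v(1) by (rule not_less_Least)
    then have "\<forall>m<v. F (pr a m) s \<ge> 2" by (simp add: not_le numeral_2_eq_2 Suc_le_eq)
    with v show "?R a s v" by blast
  next
    assume R: "?R a s v"
    then have "(LEAST m. m \<ge> s \<or> F (pr a m) s \<le> 1) = v"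
      by (intro Least_equality) (auto simp: not_less[symmetric])
    with R show "?F a s = Suc v" by simp
  qed
  have f_eq: "?f a = Some v \<longleftrightarrow> f (pr a v) = Some 0 \<and> (\<forall>m<v. \<exists>w. f (pr a m) = Some (Suc w))" for a v
  proof
    assume "?f a = Some v"
    then obtain n where n: "f (pr a n) = Some 0" "\<forall>m<n. f (pr a m) \<noteq> None"
      and v: "v = (LEAST n. f (pr a n) = Some 0)" by (auto split: if_splits)
    have "v \<le> n" unfolding v using n(1) by (rule Least_le)
    moreover have "f (pr a v) = Some 0" unfolding v using n(1) by (rule LeastI)
    moreover have "f (pr a m) \<noteq> Some 0" if "m < v" for m
      using that unfolding v by (rule not_less_Least)
    ultimately show "f (pr a v) = Some 0 \<and> (\<forall>m<v. \<exists>w. f (pr a m) = Some (Suc w))"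
      using n(2) by (metis less_le_trans not0_implies_Suc option.exhaust)
  next
    assume R: "f (pr a v) = Some 0 \<and> (\<forall>m<v. \<exists>w. f (pr a m) = Some (Suc w))"
    then have "(LEAST n. f (pr a n) = Some 0) = v"
      by (intro Least_equality) (auto, metis not_less option.inject nat.distinct(1))
    moreover have "\<exists>n. f (pr a n) = Some 0 \<and> (\<forall>m<n. f (pr a m) \<noteq> None)"
      using R by (intro exI[of _ v]) auto
    ultimately show "?f a = Some v" by simp
  qed
  have c1: "computable (\<lambda>x. ?F (pfst x) (psnd x))"
    by (intro cintros stages_computable[OF F]) auto
  have c2: "?R a t v" if "s \<le> t" "?R a s v" for a s t v
  proof -
    have "F (pr a m) t \<ge> 2" if m: "m < v" for m
      using \<open>?R a s v\<close> m stages_mono[OF F _ \<open>s \<le> t\<close>, of "pr a m" "F (pr a m) s - 1"] by fastforce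
    then show ?thesis using that stages_mono[OF F _ that(1), of "pr a v" 0] by auto
  qed
  have c3: "f (pr a v) = Some 0 \<and> (\<forall>m<v. \<exists>w. f (pr a m) = Some (Suc w)) \<longleftrightarrow> (\<exists>s. ?R a s v)" for a v
  proof
    assume R: "f (pr a v) = Some 0 \<and> (\<forall>m<v. \<exists>w. f (pr a m) = Some (Suc w))"
    then have "\<forall>m\<le>v. \<exists>s w. f (pr a m) = Some w \<and> F (pr a m) s = Suc w"
      using stages_SomeE[OF F] by (metis le_eq_less_or_eq)
    then obtain S where S: "\<forall>m\<le>v. \<exists>w. f (pr a m) = Some w \<and> F (pr a m) (S m) = Suc w" by metis
    \<comment> \<open>The sum dominates each of the finitely many stages \<open>S m\<close>, and
      \<open>Suc v\<close> puts the witness \<open>v\<close> inside the search bound.\<close>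
    define t where "t = Suc v + (\<Sum>m\<le>v. S m)"
    have "S m \<le> t" if "m \<le> v" for m
      using member_le_sum[of m "{..v}" S] that by (simp add: t_def)
    then have t: "\<forall>m\<le>v. \<exists>w. f (pr a m) = Some w \<and> F (pr a m) t = Suc w"
      using S stages_mono[OF F] by blast
    have "?R a t v"
    proof (intro conjI allI impI)
      show "v < t" by (simp add: t_def)
      show "F (pr a v) t = 1" using t[rule_format, of v] R by auto
      show "F (pr a m) t \<ge> 2" if "m < v" for m
        using t[rule_format, of m] R that by fastforce
    qed
    then show "\<exists>s. ?R a s v" ..
  next
    assume "\<exists>s. ?R a s v"
    then obtain s where s: "?R a s v" ..
    have "\<exists>w. f (pr a m) = Some (Suc w)" if "m < v" for m
      using s that stages_SomeI[OF F, of "pr a m" s "F (pr a m) s - 1"]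
      by (intro exI[of _ "F (pr a m) s - 2"]) (fastforce simp: Suc_diff_le numeral_2_eq_2)
    then show "f (pr a v) = Some 0 \<and> (\<forall>m<v. \<exists>w. f (pr a m) = Some (Suc w))"
      using s stages_SomeI[OF F, of "pr a v" s 0] by simp
  qed
  show ?thesis
    unfolding stages_def F_eq f_eq using c1 c2 c3 by blast
qed

lemma partial_computable_stages: "partial_computable f \<Longrightarrow> \<exists>F. stages f F"
proof (induction rule: partial_computable.induct)
  case zero
  show ?case using stages_total[OF computable_const] by blast
next
  case succ
  show ?case using stages_total[OF computable_Suc[OF computable_id]] by blast
next
  case left
  show ?case using stages_total[OF computable_pfst[OF computable_id]] by blast
next
  case right
  show ?case using stages_total[OF computable_psnd[OF computable_id]] by blast
next
  case (pair f g)
  then show ?case using stages_pair by blast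
next
  case (comp f g)
  then show ?case using stages_comp by blast
next
  case (prim_rec f g)
  then show ?case using stages_prim_rec by blast
next
  case (minim f)
  then show ?case using stages_minim by blast
qed

section \<open>Countability of the class of partial computable functions\<close>

datatype program = Zero | Succ | Left | Right | Pair program program | Comp program program
  | Rec program program | Minim program

instance program :: countable
  by countable_datatype

primrec run :: "program \<Rightarrow> nat \<rightharpoonup> nat" where
  "run Zero = (\<lambda>_. Some 0)"
| "run Succ = (\<lambda>n. Some (Suc n))"
| "run Left = (\<lambda>n. Some (pfst n))"
| "run Right = (\<lambda>n. Some (psnd n))"
| "run (Pair p q) = (\<lambda>n. Option.bind (run p n) (\<lambda>a. Option.bind (run q n) (\<lambda>b. Some (pr a b))))"
| "run (Comp p q) = (\<lambda>n. Option.bind (run p n) (run q))"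
| "run (Rec p q) = (\<lambda>n. case prod_decode n of (a, k) \<Rightarrow>
     rec_nat (run p a) (\<lambda>i r. Option.bind r (\<lambda>v. run q (pr a (pr i v)))) k)"
| "run (Minim p) = (\<lambda>a. if \<exists>n. run p (pr a n) = Some 0 \<and> (\<forall>m<n. run p (pr a m) \<noteq> None)
     then Some (LEAST n. run p (pr a n) = Some 0) else None)"

text \<open>Back-and-forth needs a countable set of non-standard elements. Programs serve only as
  names for derivations of \<open>partial_computable\<close>, of which there are countably
  many.\<close>

lemma countable_partial_computable: "countable {f. partial_computable f}"
proof -
  have "\<exists>p. f = run p" if "partial_computable f" for f
    using that
  proof (induction rule: partial_computable.induct)
    case zero
    show ?case by (rule exI[of _ Zero]) simp
  next
    case succ
    show ?case by (rule exI[of _ Succ]) simp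
  next
    case left
    show ?case by (rule exI[of _ Left]) simp
  next
    case right
    show ?case by (rule exI[of _ Right]) simp
  next
    case (pair f g)
    then obtain p q where "f = run p" "g = run q" by blast
    then show ?case by (intro exI[of _ "Pair p q"]) simp
  next
    case (comp f g)
    then obtain p q where "f = run p" "g = run q" by blast
    then show ?case by (intro exI[of _ "Comp p q"]) simp
  next
    case (prim_rec f g)
    then obtain p q where "f = run p" "g = run q" by blast
    then show ?case by (intro exI[of _ "Rec p q"]) simp
  next
    case (minim f)
    then obtain p where "f = run p" by blast
    then show ?case by (intro exI[of _ "Minim p"]) (simp only: run.simps)
  qed
  then have "{f. partial_computable f} \<subseteq> range run" by blast
  then show ?thesis by (rule countable_subset) simp
qed

subsection \<open>Cohesive sets with computably enumerable complement\<close>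

text \<open>\<open>Cs s\<close> is what remains of the natural numbers after the elements enumerated
  into the complement of \<open>C\<close> by stage \<open>s\<close> are removed: a decidable
  approximation to \<open>C\<close> from above.\<close>

locale cohesive_set =
  fixes C :: "nat set" and Cs :: "nat \<Rightarrow> nat set"
  assumes cohesive: "cohesive C"
    and decidable_Cs: "decidable (\<lambda>x. pfst x \<in> Cs (psnd x))"
    and Cs_antimono: "s \<le> t \<Longrightarrow> Cs t \<subseteq> Cs s"
    and C_eq: "C = (\<Inter>s. Cs s)"
begin

text \<open>\<open>eventually P U\<close> says that \<open>P\<close> holds almost everywhere on
  \<open>C\<close>. By cohesiveness, \<open>U\<close> behaves like an ultrafilter on c.e.
  predicates.\<close>

definition U :: "nat filter" where
  "U = inf cofinite (principal C)"

lemma eventually_U: "eventually P U \<longleftrightarrow> finite {n \<in> C. \<not> P n}"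
  by (simp add: U_def eventually_inf_principal eventually_cofinite)

lemma almost_subset_iff: "C \<subseteq>\<^sup>* {n. P n} \<longleftrightarrow> eventually P U"
  by (simp add: almost_subset_def eventually_U set_diff_eq)

lemma U_neq_bot [simp]: "U \<noteq> bot"
  using cohesive by (simp add: trivial_limit_def eventually_U cohesive_def)

lemma eventually_U_C: "eventually (\<lambda>n. n \<in> C) U"
  by (simp add: eventually_U)

lemma eventually_U_ge: "eventually (\<lambda>n. b \<le> n) U"
  unfolding eventually_U by (rule finite_subset[of _ "{..<b}"]) auto

lemma eventually_U_E:
  assumes "eventually P U"
  obtains b where "\<And>n. n \<in> C \<Longrightarrow> b \<le> n \<Longrightarrow> P n"
proof -
  from assms obtain b where "\<forall>n\<in>{n \<in> C. \<not> P n}. n < b"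
    unfolding eventually_U finite_nat_set_iff_bounded by blast
  then show ?thesis using that[of b] by force
qed

lemma ce_dichotomy: "ce {n. P n} \<Longrightarrow> eventually P U \<or> eventually (\<lambda>n. \<not> P n) U"
  using cohesive by (auto simp: cohesive_def eventually_U set_diff_eq Int_def)

lemma decidable_dichotomy: "decidable P \<Longrightarrow> eventually P U \<or> eventually (\<lambda>n. \<not> P n) U"
  by (rule ce_dichotomy[OF decidable_imp_ce])

lemma filterlim_U:
  assumes "\<And>m. finite {n. h n < m}"
  shows "filterlim (h :: nat \<Rightarrow> nat) at_top U"
  unfolding filterlim_at_top eventually_U
proof
  show "finite {n \<in> C. \<not> m \<le> h n}" for m
    by (rule finite_subset[OF _ assms[of m]]) auto
qed

lemma decidable_in_Cs [cintros]: "computable f \<Longrightarrow> computable g \<Longrightarrow> decidable (\<lambda>x. f x \<in> Cs (g x))"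
  using decidable_comp[OF decidable_Cs computable_pair, of f g] by simp

lemma C_subset_Cs: "C \<subseteq> Cs s"
  by (auto simp: C_eq)

lemma Cs_agree: "\<exists>s. \<forall>m\<le>b. m \<in> Cs s \<longleftrightarrow> m \<in> C"
proof (induction b)
  case 0
  then show ?case by (auto simp: C_eq)
next
  case (Suc b)
  then obtain s where s: "\<forall>m\<le>b. m \<in> Cs s \<longleftrightarrow> m \<in> C" ..
  obtain t where t: "Suc b \<in> Cs t \<longleftrightarrow> Suc b \<in> C" by (auto simp: C_eq)
  have "m \<in> Cs (max s t) \<longleftrightarrow> m \<in> C" if "m \<le> Suc b" for m
    using that s t Cs_antimono[of s "max s t"] Cs_antimono[of t "max s t"] C_subset_Cs[of "max s t"]
    by (auto simp: le_Suc_eq)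
  then show ?case by blast
qed

section \<open>Growth of computable functions along \<open>C\<close>\<close>

text \<open>There are infinitely many \<open>n \<in> C\<close> at which \<open>h\<close> attains a new maximum over \<open>C\<close>, and those \<open>n\<close> are
  contained in the c.e. set \<open>W\<close> of the proof. By cohesiveness \<open>W\<close> then contains almost all of \<open>C\<close>.\<close>

lemma eventually_increasing:
  assumes h: "computable h" and lim: "filterlim h at_top U"
  shows "eventually (\<lambda>n. \<forall>m\<in>C. m < n \<longrightarrow> h m < h n) U"
proof -
  \<comment> \<open>Quantifying over the superset \<open>Cs s\<close> keeps the matrix decidable,
    and nothing is lost because some stage agrees with \<open>C\<close> below
    \<open>n\<close>.\<close>
  define W where "W n \<longleftrightarrow> (\<exists>s. \<forall>m<n. m \<in> Cs s \<longrightarrow> h m < h n)" for n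
  have W_iff: "W n \<longleftrightarrow> (\<forall>m\<in>C. m < n \<longrightarrow> h m < h n)" for n
  proof
    show "W n \<Longrightarrow> \<forall>m\<in>C. m < n \<longrightarrow> h m < h n"
      using C_subset_Cs by (auto simp: W_def)
    assume *: "\<forall>m\<in>C. m < n \<longrightarrow> h m < h n"
    obtain s where "\<forall>m\<le>n. m \<in> Cs s \<longleftrightarrow> m \<in> C" using Cs_agree by blast
    with * show "W n" unfolding W_def by (intro exI[of _ s]) auto
  qed
  have "ce {n. W n}"
    unfolding W_def by (intro ce_Ex_decidable cintros computable_comp[OF h])
  then have "eventually W U \<or> eventually (\<lambda>n. \<not> W n) U" by (rule ce_dichotomy)
  moreover have "\<not> eventually (\<lambda>n. \<not> W n) U"
  proof
    assume "eventually (\<lambda>n. \<not> W n) U"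
    then obtain b where b: "\<And>n. n \<in> C \<Longrightarrow> b \<le> n \<Longrightarrow> \<not> W n" by (rule eventually_U_E) blast
    \<comment> \<open>\<open>t\<close> exceeds all values of \<open>h\<close> below
      \<open>b\<close>, so the first \<open>n\<close> in \<open>C\<close> with
      \<open>t \<le> h n\<close> is at least \<open>b\<close>; being the first, it is also a new
      maximum over \<open>C\<close>.\<close>
    define t where "t = Suc (\<Sum>m<b. h m)"
    have small: "h m < t" if "m < b" for m
      using member_le_sum[of m "{..<b}" h] that by (simp add: t_def)
    have "eventually (\<lambda>n. n \<in> C \<and> t \<le> h n) U"
      using lim eventually_U_C by (auto simp: filterlim_at_top intro: eventually_conj)
    then have ex: "\<exists>n. n \<in> C \<and> t \<le> h n" using eventually_happens'[OF U_neq_bot] by blast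
    define n where "n = (LEAST n. n \<in> C \<and> t \<le> h n)"
    have n: "n \<in> C" "t \<le> h n" using LeastI_ex[OF ex] by (simp_all add: n_def)
    have "h m < h n" if "m \<in> C" "m < n" for m
      using not_less_Least[of m "\<lambda>n. n \<in> C \<and> t \<le> h n"] that n by (auto simp: n_def[symmetric])
    then have "W n" by (simp add: W_iff)
    moreover have "b \<le> n" using small[of n] n(2) by (meson not_le)
    ultimately show False using b n(1) by blast
  qed
  ultimately have "eventually W U" by blast
  then show ?thesis by (rule eventually_mono) (simp add: W_iff)
qed

text \<open>From some \<open>b\<close> on, \<open>h\<close> is strictly increasing on
  \<open>C\<close>, so it maps the elements of \<open>C\<close> from \<open>b\<close> up to
  \<open>n\<close> injectively below \<open>h n\<close>. The constant pays for the numbers below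
  \<open>b\<close>.\<close>

lemma card_below_bound:
  assumes h: "computable h" and lim: "filterlim h at_top U"
  shows "\<exists>c. \<forall>n\<in>C. card (C \<inter> {..<n}) \<le> h n + c"
proof -
  obtain b where b: "\<And>n. n \<in> C \<Longrightarrow> b \<le> n \<Longrightarrow> \<forall>m\<in>C. m < n \<longrightarrow> h m < h n"
    using eventually_increasing[OF assms] by (rule eventually_U_E) blast
  have "card (C \<inter> {..<n}) \<le> h n + b" if n: "n \<in> C" for n
  proof -
    have "inj_on h (C \<inter> {b..<n})"
    proof (rule linorder_inj_onI)
      fix x y assume "x < y" "x \<in> C \<inter> {b..<n}" "y \<in> C \<inter> {b..<n}"
      then show "h x \<noteq> h y" using b[of y] by fastforce
    qed auto
    moreover have "h ` (C \<inter> {b..<n}) \<subseteq> {..<h n}" using b[OF n] by auto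
    ultimately have *: "card (C \<inter> {b..<n}) \<le> h n"
      using card_inj_on_le[of h "C \<inter> {b..<n}" "{..<h n}"] by simp
    have "C \<inter> {..<n} \<subseteq> (C \<inter> {b..<n}) \<union> {..<b}" by auto
    then have "card (C \<inter> {..<n}) \<le> card ((C \<inter> {b..<n}) \<union> {..<b})" by (intro card_mono) auto
    also have "\<dots> \<le> card (C \<inter> {b..<n}) + card {..<b}" by (rule card_Un_le)
    finally show ?thesis using * by simp
  qed
  then show ?thesis by blast
qed

text \<open>The inverse \<open>h n = (LEAST k. n \<le> g k)\<close> is computable and tends to
  infinity, hence is strictly increasing on almost all of \<open>C\<close>. So a later element
  \<open>n'\<close> of \<open>C\<close> has \<open>h n' > h n\<close>, which means that it lies
  beyond \<open>g (h n)\<close>.\<close>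

lemma eventually_gap_increasing:
  assumes g: "computable g" "\<And>k. k \<le> g k"
  shows "eventually (\<lambda>n. \<forall>n'\<in>C. n < n' \<longrightarrow> g (LEAST k. n \<le> g k) < n') U"
proof -
  define h where "h n = (LEAST k. n \<le> g k)" for n
  have h: "n \<le> g (h n)" for n unfolding h_def by (rule LeastI[of _ n]) (rule g)
  have "computable h" unfolding h_def
    by (intro cintros computable_comp[OF g(1)]) (use g(2) in blast)
  moreover have "filterlim h at_top U"
  proof (rule filterlim_U)
    fix m
    have "n \<le> (\<Sum>i<m. g i)" if "h n < m" for n
      using h[of n] member_le_sum[of "h n" "{..<m}" g] that by simp
    then have "{n. h n < m} \<subseteq> {..\<Sum>i<m. g i}" by (simp add: subset_eq)
    then show "finite {n. h n < m}" by (rule finite_subset) simp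
  qed
  ultimately obtain b where b: "\<And>n. n \<in> C \<Longrightarrow> b \<le> n \<Longrightarrow> \<forall>m\<in>C. m < n \<longrightarrow> h m < h n"
    using eventually_U_E[OF eventually_increasing] by metis
  have "g (h n) < n'" if "b \<le> n" "n \<in> C" "n' \<in> C" "n < n'" for n n'
    using b[of n'] that not_less_Least[of "h n" "\<lambda>k. n' \<le> g k"] by (auto simp: h_def)
  then show ?thesis
    using eventually_conj[OF eventually_U_C eventually_U_ge[of b]]
    by (auto simp: h_def elim: eventually_mono)
qed

text \<open>With thresholds \<open>g k\<close> such that \<open>f n \<le> g (Suc k)\<close> whenever
  \<open>n \<le> g k\<close>, the next element of \<open>C\<close> has to pass the second threshold
  after \<open>n\<close>; a single inverse only yields the first. The inverses along the even and
  along the odd indices both apply, and one of the two thresholds they give is at least the second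
  one.\<close>

lemma eventually_gap:
  assumes f: "computable f"
  shows "eventually (\<lambda>n. C \<inter> {n<..f n} = {}) U"
proof -
  define g where "g k = rec_nat 0 (\<lambda>_ v. Suc (v + (\<Sum>m<Suc v. f m))) k" for k
  have g_Suc: "g (Suc k) = Suc (g k + (\<Sum>m<Suc (g k). f m))" for k by (simp add: g_def)
  have comp: "computable g" unfolding g_def by (intro cintros computable_comp[OF f])
  have ge: "k \<le> g k" for k by (induction k) (auto simp: g_Suc)
  have mono: "mono g" by (rule monoI[OF lift_Suc_mono_le]) (auto simp: g_Suc)
  have f_le: "f n \<le> g (Suc k)" if "n \<le> g k" for n k
    using member_le_sum[of n "{..<Suc (g k)}" f] that unfolding g_Suc by simp
  have "eventually (\<lambda>n. \<forall>n'\<in>C. n < n' \<longrightarrow> g (2 * (LEAST k. n \<le> g (2 * k))) < n') U"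
  proof (rule eventually_gap_increasing)
    show "computable (\<lambda>k. g (2 * k))" by (intro computable_comp[OF comp] cintros)
    show "k \<le> g (2 * k)" for k using ge[of "2 * k"] by linarith
  qed
  moreover have "eventually (\<lambda>n. \<forall>n'\<in>C. n < n' \<longrightarrow> g (Suc (2 * (LEAST k. n \<le> g (Suc (2 * k))))) < n') U"
  proof (rule eventually_gap_increasing)
    show "computable (\<lambda>k. g (Suc (2 * k)))" by (intro computable_comp[OF comp] cintros)
    show "k \<le> g (Suc (2 * k))" for k using ge[of "Suc (2 * k)"] by linarith
  qed
  ultimately show ?thesis
  proof eventually_elim
    case (elim n)
    define p where "p = (LEAST k. n \<le> g (2 * k))"
    define q where "q = (LEAST k. n \<le> g (Suc (2 * k)))"
    have p: "n \<le> g (2 * p)" unfolding p_def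
      by (rule LeastI[of _ n]) (use ge[of "2 * n"] in linarith)
    have q: "n \<le> g (Suc (2 * q))" unfolding q_def
      by (rule LeastI[of _ n]) (use ge[of "Suc (2 * n)"] in linarith)
    \<comment> \<open>Whichever of the indices \<open>2 * p\<close> and \<open>Suc (2 * q)\<close>
      is larger comes at least one index after another threshold that already bounds
      \<open>n\<close>.\<close>
    have "f n \<le> g (2 * p) \<or> f n \<le> g (Suc (2 * q))"
    proof (cases "p \<le> q")
      case True
      then have "g (Suc (2 * p)) \<le> g (Suc (2 * q))" by (intro monoD[OF mono]) simp
      then show ?thesis using f_le[OF p] by linarith
    next
      case False
      then have "g (Suc (Suc (2 * q))) \<le> g (2 * p)" by (intro monoD[OF mono]) simp
      then show ?thesis using f_le[OF q] by linarith
    qed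
    then show ?case using elim unfolding p_def[symmetric] q_def[symmetric] by fastforce
  qed
qed

text \<open>By the gap, the elements of \<open>C\<close> up to \<open>f n\<close> are at most
  \<open>n\<close> and those below it. Their number is at most \<open>h n + c + 1\<close>, which is
  at most \<open>2 * h n\<close> as soon as \<open>h n\<close> exceeds \<open>c\<close>.\<close>

lemma card_C_bound:
  assumes "computable f" "computable h" "filterlim h at_top U"
  shows "eventually (\<lambda>n. card (C \<inter> {..f n}) \<le> 2 * h n) U"
proof -
  obtain c where c: "\<forall>n\<in>C. card (C \<inter> {..<n}) \<le> h n + c"
    using card_below_bound[OF assms(2,3)] ..
  have "eventually (\<lambda>n. Suc c \<le> h n) U" using assms(3) by (simp add: filterlim_at_top)
  with eventually_gap[OF assms(1)] eventually_U_C show ?thesis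
  proof eventually_elim
    case (elim n)
    then have "C \<inter> {..f n} \<subseteq> insert n (C \<inter> {..<n})" by (force simp: not_less)
    then have "card (C \<inter> {..f n}) \<le> card (insert n (C \<inter> {..<n}))" by (intro card_mono) auto
    also have "\<dots> = Suc (card (C \<inter> {..<n}))" by simp
    finally show ?case using c elim by fastforce
  qed
qed

text \<open>For each \<open>n\<close> wait until the computation stops, or \<open>n\<close> leaves
  \<open>Cs s\<close>, or \<open>n < b\<close>, where \<open>b\<close> bounds the exceptions in
  \<open>C\<close>. One of these always happens, and values produced for the latter two reasons
  affect only finitely many elements of \<open>C\<close>.\<close>

lemma total_representative:
  assumes "partial_computable \<phi>" "C \<subseteq>\<^sup>* dom \<phi>"
  shows "\<exists>f. computable f \<and> eventually (\<lambda>n. \<phi> n = Some (f n)) U"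
proof -
  obtain F where F: "stages \<phi> F" using partial_computable_stages[OF assms(1)] ..
  have "eventually (\<lambda>n. n \<in> dom \<phi>) U" using assms(2) by (simp add: almost_subset_iff[symmetric])
  then obtain b where b: "\<And>n. n \<in> C \<Longrightarrow> b \<le> n \<Longrightarrow> n \<in> dom \<phi>" by (rule eventually_U_E) blast
  define S where "S n = (LEAST s. F n s \<noteq> 0 \<or> n \<notin> Cs s \<or> n < b)" for n
  have ex: "\<exists>s. F n s \<noteq> 0 \<or> n \<notin> Cs s \<or> n < b" for n
  proof (cases "n \<in> C \<and> b \<le> n")
    case True
    then obtain v where "\<phi> n = Some v" using b by blast
    then show ?thesis using stages_SomeE[OF F] by (metis nat.distinct(1))
  next
    case False
    then show ?thesis by (auto simp: C_eq)
  qed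
  have "computable S" unfolding S_def by (intro cintros stages_computable[OF F] ex)
  then have "computable (\<lambda>n. F n (S n) - 1)" by (intro cintros stages_computable[OF F])
  moreover have "eventually (\<lambda>n. \<phi> n = Some (F n (S n) - 1)) U"
    using eventually_U_C eventually_U_ge[of b]
  proof eventually_elim
    case (elim n)
    have "F n (S n) \<noteq> 0 \<or> n \<notin> Cs (S n) \<or> n < b" unfolding S_def by (rule LeastI_ex[OF ex])
    then have "F n (S n) = Suc (F n (S n) - 1)" using elim C_subset_Cs by auto
    then show ?case using stages_SomeI[OF F] by blast
  qed
  ultimately show ?thesis by blast
qed

end

lemma cohesive_set_exists:
  assumes "cohesive C" "ce (- C)"
  shows "\<exists>Cs. cohesive_set C Cs"
proof -
  obtain \<phi> where \<phi>: "partial_computable \<phi>" "- C = dom \<phi>" using assms(2) by (auto simp: ce_def)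
  obtain F where F: "stages \<phi> F" using partial_computable_stages[OF \<phi>(1)] ..
  have "cohesive_set C (\<lambda>s. {n. F n s = 0})"
  proof
    show "decidable (\<lambda>x. pfst x \<in> {n. F n (psnd x) = 0})"
      unfolding mem_Collect_eq by (intro cintros stages_computable[OF F])
    show "{n. F n t = 0} \<subseteq> {n. F n s = 0}" if "s \<le> t" for s t
      using stages_mono[OF F _ that] by (auto, metis not0_implies_Suc)
    have dom: "n \<in> dom \<phi> \<longleftrightarrow> (\<exists>s. F n s \<noteq> 0)" for n
      using stages_SomeI[OF F, of n] stages_SomeE[OF F, of n] by (metis domIff not0_implies_Suc not_None_eq nat.distinct(1))
    have "C = - dom \<phi>" by (simp flip: \<phi>(2))
    then show "C = (\<Inter>s. {n. F n s = 0})" by (simp only: set_eq_iff Compl_iff dom) simp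
  qed (fact assms(1))
  then show ?thesis by blast
qed

subsection \<open>Colored dense orders\<close>

text \<open>The orders are strict weak orders: elements of \<open>S\<close> that \<open>lt\<close> does not distinguish play the role of
  representatives of the same point, so that no quotient has to be formed.\<close>

definition dense_colored :: "'a set \<Rightarrow> ('a \<Rightarrow> 'a \<Rightarrow> bool) \<Rightarrow> ('a \<Rightarrow> 'c) \<Rightarrow> 'c set \<Rightarrow> bool" where
  "dense_colored S lt col X \<longleftrightarrow> countable S \<and> S \<noteq> {} \<and> col ` S \<subseteq> X \<and>
     (\<forall>x\<in>S. \<forall>y\<in>S. lt x y \<longrightarrow> \<not> lt y x) \<and>
     (\<forall>x\<in>S. \<forall>y\<in>S. \<forall>z\<in>S. lt x z \<longrightarrow> lt x y \<or> lt y z) \<and>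
     (\<forall>x\<in>S. \<forall>y\<in>S. \<not> lt x y \<longrightarrow> \<not> lt y x \<longrightarrow> col x = col y) \<and>
     (\<forall>c\<in>X. \<forall>x\<in>S. \<forall>y\<in>S. lt x y \<longrightarrow> (\<exists>z\<in>S. col z = c \<and> lt x z \<and> lt z y)) \<and>
     (\<forall>c\<in>X. \<forall>x\<in>S. (\<exists>z\<in>S. col z = c \<and> lt x z) \<and> (\<exists>z\<in>S. col z = c \<and> lt z x))"

lemma dense_coloredD:
  assumes "dense_colored S lt col X"
  shows "countable S" "S \<noteq> {}" "x \<in> S \<Longrightarrow> col x \<in> X"
    and "x \<in> S \<Longrightarrow> y \<in> S \<Longrightarrow> lt x y \<Longrightarrow> \<not> lt y x"
    and "x \<in> S \<Longrightarrow> y \<in> S \<Longrightarrow> z \<in> S \<Longrightarrow> lt x z \<Longrightarrow> lt x y \<or> lt y z"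
    and "x \<in> S \<Longrightarrow> y \<in> S \<Longrightarrow> \<not> lt x y \<Longrightarrow> \<not> lt y x \<Longrightarrow> col x = col y"
    and "c \<in> X \<Longrightarrow> x \<in> S \<Longrightarrow> y \<in> S \<Longrightarrow> lt x y \<Longrightarrow> \<exists>z\<in>S. col z = c \<and> lt x z \<and> lt z y"
    and "c \<in> X \<Longrightarrow> x \<in> S \<Longrightarrow> \<exists>z\<in>S. col z = c \<and> lt x z"
    and "c \<in> X \<Longrightarrow> x \<in> S \<Longrightarrow> \<exists>z\<in>S. col z = c \<and> lt z x"
  using assms unfolding dense_colored_def by blast+

lemma dense_colored_trans:
  assumes "dense_colored S lt col X" "x \<in> S" "y \<in> S" "z \<in> S" "lt x y" "lt y z"
  shows "lt x z"
  using dense_coloredD(4)[OF assms(1), of y z] dense_coloredD(5)[OF assms(1), of x z y] assms(2-) by blast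

text \<open>In a strict weak order a maximal element may be tied with others and so is not above
  them; what survives is that anything above \<open>m\<close> is above all of
  \<open>A\<close>.\<close>

lemma dense_colored_max:
  assumes D: "dense_colored S lt col X" and "finite A" "A \<noteq> {}" "A \<subseteq> S"
  shows "\<exists>m\<in>A. \<forall>z\<in>S. lt m z \<longrightarrow> (\<forall>a\<in>A. lt a z)"
  using assms(2-)
proof (induction A rule: finite_ne_induct)
  case (singleton x)
  then show ?case by blast
next
  case (insert x A)
  then obtain m where m: "m \<in> A" "\<forall>z\<in>S. lt m z \<longrightarrow> (\<forall>a\<in>A. lt a z)" by auto
  show ?case
  proof (cases "lt m x")
    case True
    have "lt m z" if "z \<in> S" "lt x z" for z
      using dense_colored_trans[OF D, of m x z] True that insert.prems m(1) by blast
    then show ?thesis using m(2) by blast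
  next
    case False
    then have "lt x z" if "z \<in> S" "lt m z" for z
      using dense_coloredD(5)[OF D, of m x z] that insert.prems m(1) by blast
    then show ?thesis using m by blast
  qed
qed

lemma dense_colored_converse: "dense_colored S lt col X \<Longrightarrow> dense_colored S (\<lambda>x y. lt y x) col X"
  by (subst dense_colored_def) (intro conjI ballI impI; (blast dest: dense_coloredD))

lemma dense_colored_between:
  assumes D: "dense_colored S lt col X" and c: "c \<in> X"
    and A: "finite A" "A \<subseteq> S" and B: "finite B" "B \<subseteq> S" and AB: "\<And>a b. a \<in> A \<Longrightarrow> b \<in> B \<Longrightarrow> lt a b"
  shows "\<exists>z\<in>S. col z = c \<and> (\<forall>a\<in>A. lt a z) \<and> (\<forall>b\<in>B. lt z b)"
proof -
  have max: "\<exists>m\<in>A. \<forall>z\<in>S. lt m z \<longrightarrow> (\<forall>a\<in>A. lt a z)" if "A \<noteq> {}"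
    using dense_colored_max[OF D A(1) that A(2)] .
  have min: "\<exists>m\<in>B. \<forall>z\<in>S. lt z m \<longrightarrow> (\<forall>b\<in>B. lt z b)" if "B \<noteq> {}"
    using dense_colored_max[OF dense_colored_converse[OF D] B(1) that B(2)] .
  show ?thesis
  proof (cases "A = {}"; cases "B = {}")
    assume "A = {}" "B = {}"
    then show ?thesis using dense_coloredD(2,8)[OF D] c by fastforce
  next
    assume AB: "A = {}" "B \<noteq> {}"
    then obtain m where "m \<in> B" "\<forall>z\<in>S. lt z m \<longrightarrow> (\<forall>b\<in>B. lt z b)" using min by blast
    then show ?thesis using dense_coloredD(9)[OF D c, of m] AB B by blast
  next
    assume AB: "A \<noteq> {}" "B = {}"
    then obtain m where "m \<in> A" "\<forall>z\<in>S. lt m z \<longrightarrow> (\<forall>b\<in>A. lt b z)" using max by blast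
    then show ?thesis using dense_coloredD(8)[OF D c, of m] AB A by blast
  next
    assume ne: "A \<noteq> {}" "B \<noteq> {}"
    obtain a where a: "a \<in> A" "\<forall>z\<in>S. lt a z \<longrightarrow> (\<forall>b\<in>A. lt b z)" using max[OF ne(1)] by blast
    obtain b where b: "b \<in> B" "\<forall>z\<in>S. lt z b \<longrightarrow> (\<forall>b\<in>B. lt z b)" using min[OF ne(2)] by blast
    show ?thesis using dense_coloredD(7)[OF D c, of a b] a b AB A B by blast
  qed
qed

text \<open>A relation instead of an injection: tied elements of \<open>S\<close> have to share
  their partner.\<close>

definition partial_iso :: "'a set \<Rightarrow> ('a \<Rightarrow> 'a \<Rightarrow> bool) \<Rightarrow> ('a \<Rightarrow> 'c) \<Rightarrow>
    'b set \<Rightarrow> ('b \<Rightarrow> 'b \<Rightarrow> bool) \<Rightarrow> ('b \<Rightarrow> 'c) \<Rightarrow> ('a \<times> 'b) set \<Rightarrow> bool" where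
  "partial_iso S lt col T lt' col' p \<longleftrightarrow> p \<subseteq> S \<times> T \<and>
     (\<forall>(x, q)\<in>p. col x = col' q) \<and> (\<forall>(x, q)\<in>p. \<forall>(y, r)\<in>p. lt x y \<longleftrightarrow> lt' q r)"

lemma partial_isoI:
  assumes "p \<subseteq> S \<times> T" "\<And>x q. (x, q) \<in> p \<Longrightarrow> col x = col' q"
    "\<And>x q y r. (x, q) \<in> p \<Longrightarrow> (y, r) \<in> p \<Longrightarrow> lt x y \<longleftrightarrow> lt' q r"
  shows "partial_iso S lt col T lt' col' p"
  unfolding partial_iso_def case_prod_beta using assms by force

lemma partial_isoD:
  assumes "partial_iso S lt col T lt' col' p"
  shows "(x, q) \<in> p \<Longrightarrow> x \<in> S" "(x, q) \<in> p \<Longrightarrow> q \<in> T" "(x, q) \<in> p \<Longrightarrow> col x = col' q"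
    "(x, q) \<in> p \<Longrightarrow> (y, r) \<in> p \<Longrightarrow> lt x y \<longleftrightarrow> lt' q r"
  using assms by (auto simp: partial_iso_def)

lemma partial_iso_converse: "partial_iso S lt col T lt' col' p \<Longrightarrow> partial_iso T lt' col' S lt col (p\<inverse>)"
  by (rule partial_isoI) (auto dest: partial_isoD)

text \<open>If \<open>x\<close> is tied with an element already matched, it inherits the partner of
  that element, of the right color since ties have equal colors. Otherwise \<open>x\<close> cuts the
  matched elements into a lower and an upper part, and a partner is found between the images of the
  two parts.\<close>

lemma partial_iso_forth:
  assumes D: "dense_colored S lt col X" and D': "dense_colored T lt' col' X"
    and p: "partial_iso S lt col T lt' col' p" "finite p" and x: "x \<in> S"
  shows "\<exists>q. partial_iso S lt col T lt' col' (insert (x, q) p)"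
proof (cases "\<exists>(y, r)\<in>p. \<not> lt x y \<and> \<not> lt y x")
  case True
  then obtain y r where y: "(y, r) \<in> p" "\<not> lt x y" "\<not> lt y x" by auto
  have yS: "y \<in> S" "r \<in> T" using partial_isoD[OF p(1)] y by blast+
  have same: "lt x z \<longleftrightarrow> lt y z" "lt z x \<longleftrightarrow> lt z y" if "z \<in> S" for z
    using y yS x that dense_coloredD(5)[OF D] by metis+
  have irr: "\<not> lt x x" "\<not> lt' r r" using dense_coloredD(4)[OF D] dense_coloredD(4)[OF D'] x yS by blast+
  have "partial_iso S lt col T lt' col' (insert (x, r) p)"
  proof (rule partial_isoI)
    show "insert (x, r) p \<subseteq> S \<times> T" using p(1) x yS by (auto simp: partial_iso_def)
    show "col z = col' s" if "(z, s) \<in> insert (x, r) p" for z s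
      using that partial_isoD(3)[OF p(1)] dense_coloredD(6)[OF D x yS(1) y(2,3)] y(1) by auto
    show "lt z w \<longleftrightarrow> lt' s t" if "(z, s) \<in> insert (x, r) p" "(w, t) \<in> insert (x, r) p" for z s w t
      using that same partial_isoD[OF p(1)] y(1) irr by auto
  qed
  then show ?thesis ..
next
  case False
  define A where "A = {r. \<exists>y. (y, r) \<in> p \<and> lt y x}"
  define B where "B = {r. \<exists>y. (y, r) \<in> p \<and> lt x y}"
  have AB: "A \<subseteq> snd ` p" "B \<subseteq> snd ` p" by (force simp: A_def B_def)+
  have "\<exists>q\<in>T. col' q = col x \<and> (\<forall>a\<in>A. lt' a q) \<and> (\<forall>b\<in>B. lt' q b)"
  proof (rule dense_colored_between[OF D' dense_coloredD(3)[OF D x]])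
    show "finite A" "finite B" using AB p(2) finite_subset by blast+
    show "A \<subseteq> T" "B \<subseteq> T" using partial_isoD[OF p(1)] by (auto simp: A_def B_def)
    fix a b assume "a \<in> A" "b \<in> B"
    then obtain y z where yz: "(y, a) \<in> p" "lt y x" "(z, b) \<in> p" "lt x z" by (auto simp: A_def B_def)
    then have "lt y z" using dense_colored_trans[OF D, of y x z] x partial_isoD(1)[OF p(1)] by blast
    then show "lt' a b" using partial_isoD(4)[OF p(1)] yz by blast
  qed
  then obtain q where q: "q \<in> T" "col' q = col x" "\<And>a. a \<in> A \<Longrightarrow> lt' a q" "\<And>b. b \<in> B \<Longrightarrow> lt' q b" by blast
  have irr: "\<not> lt x x" "\<not> lt' q q" using dense_coloredD(4)[OF D] dense_coloredD(4)[OF D'] x q by blast+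
  have cmp: "(lt x y \<longleftrightarrow> lt' q r) \<and> (lt y x \<longleftrightarrow> lt' r q)" if "(y, r) \<in> p" for y r
  proof -
    have in_ST: "y \<in> S" "r \<in> T" using partial_isoD[OF p(1)] that by blast+
    have "lt x y \<or> lt y x" using bspec[of p _ "(y, r)", OF _ that] False by auto
    then consider "lt x y" | "lt y x" by blast
    then show ?thesis
    proof cases
      case 1
      then have "lt' q r" using q(4) that by (auto simp: B_def)
      then show ?thesis using 1 in_ST x q(1) dense_coloredD(4)[OF D] dense_coloredD(4)[OF D'] by blast
    next
      case 2
      then have "lt' r q" using q(3) that by (auto simp: A_def)
      then show ?thesis using 2 in_ST x q(1) dense_coloredD(4)[OF D] dense_coloredD(4)[OF D'] by blast
    qed
  qed
  have "partial_iso S lt col T lt' col' (insert (x, q) p)"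
  proof (rule partial_isoI)
    show "insert (x, q) p \<subseteq> S \<times> T" using p(1) x q by (auto simp: partial_iso_def)
    show "col z = col' s" if "(z, s) \<in> insert (x, q) p" for z s
      using that partial_isoD(3)[OF p(1)] q(2) by auto
    show "lt z w \<longleftrightarrow> lt' s t" if "(z, s) \<in> insert (x, q) p" "(w, t) \<in> insert (x, q) p" for z s w t
      using that cmp partial_isoD(4)[OF p(1)] irr by auto
  qed
  then show ?thesis ..
qed

lemma partial_iso_back_and_forth:
  assumes D: "dense_colored S lt col X" and D': "dense_colored T lt' col' X"
  shows "\<exists>p. partial_iso S lt col T lt' col' p \<and> Domain p = S \<and> Range p = T"
proof -
  let ?good = "\<lambda>p. partial_iso S lt col T lt' col' p \<and> finite p"
  have S: "range (from_nat_into S) = S" and T: "range (from_nat_into T) = T"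
    using D D' dense_coloredD(1,2) range_from_nat_into by metis+
  \<comment> \<open>Step \<open>n\<close> adds the \<open>n\<close>-th element of each enumeration;
    the back half is the forth half for the converse relation.\<close>
  have "\<exists>P. \<forall>n::nat. ?good (P n) \<and>
      (P n \<subseteq> P (Suc n) \<and> from_nat_into S n \<in> Domain (P (Suc n)) \<and> from_nat_into T n \<in> Range (P (Suc n)))"
  proof (rule dependent_nat_choice)
    show "\<exists>p. ?good p" by (intro exI[of _ "{}"]) (simp add: partial_iso_def)
    fix p and n :: nat assume p: "?good p"
    obtain q where q: "?good (insert (from_nat_into S n, q) p)"
      using partial_iso_forth[OF D D' _ _ rangeI[of "from_nat_into S" n, unfolded S]] p by blast
    let ?p = "insert (from_nat_into S n, q) p"
    have "partial_iso T lt' col' S lt col (?p\<inverse>)" "finite (?p\<inverse>)"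
      using q partial_iso_converse by (blast, simp only: finite_converse)
    from partial_iso_forth[OF D' D this rangeI[of "from_nat_into T" n, unfolded T]]
    obtain x where "partial_iso T lt' col' S lt col (insert (from_nat_into T n, x) (?p\<inverse>))" ..
    from partial_iso_converse[OF this]
    moreover have "(insert (from_nat_into T n, x) (?p\<inverse>))\<inverse> = insert (x, from_nat_into T n) ?p" by auto
    ultimately have "partial_iso S lt col T lt' col' (insert (x, from_nat_into T n) ?p)" by metis
    then show "\<exists>p'. ?good p' \<and> (p \<subseteq> p' \<and> from_nat_into S n \<in> Domain p' \<and> from_nat_into T n \<in> Range p')"
      using q by (intro exI[of _ "insert (x, from_nat_into T n) ?p"]) auto
  qed
  then obtain P where P: "\<And>n. ?good (P n)" "\<And>n. P n \<subseteq> P (Suc n)"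
    "\<And>n. from_nat_into S n \<in> Domain (P (Suc n))" "\<And>n. from_nat_into T n \<in> Range (P (Suc n))" by blast
  have mono: "m \<le> n \<Longrightarrow> P m \<subseteq> P n" for m n using lift_Suc_mono_le[of P, OF P(2)] .
  have iso: "partial_iso S lt col T lt' col' (\<Union>n. P n)"
  proof (rule partial_isoI)
    show "(\<Union>n. P n) \<subseteq> S \<times> T" using P(1) by (auto dest: partial_isoD)
    show "col x = col' q" if "(x, q) \<in> (\<Union>n. P n)" for x q using that P(1) by (auto dest: partial_isoD)
    show "lt x y \<longleftrightarrow> lt' q r" if "(x, q) \<in> (\<Union>n. P n)" "(y, r) \<in> (\<Union>n. P n)" for x q y r
    proof -
      from that obtain m n where "(x, q) \<in> P m" "(y, r) \<in> P n" by blast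
      then have "(x, q) \<in> P (max m n)" "(y, r) \<in> P (max m n)" using mono by (meson max.cobounded1 max.cobounded2 subsetD)+
      moreover have "partial_iso S lt col T lt' col' (P (max m n))" using P(1) by blast
      ultimately show ?thesis by (intro partial_isoD(4))
    qed
  qed
  moreover have "Domain (\<Union>n. P n) = S"
  proof
    show "Domain (\<Union>n. P n) \<subseteq> S" using iso by (auto simp: partial_iso_def)
    have "from_nat_into S n \<in> Domain (\<Union>n. P n)" for n using P(3)[of n] by blast
    then have "range (from_nat_into S) \<subseteq> Domain (\<Union>n. P n)" by (intro image_subsetI)
    then show "S \<subseteq> Domain (\<Union>n. P n)" by (simp only: S)
  qed
  moreover have "Range (\<Union>n. P n) = T"
  proof
    show "Range (\<Union>n. P n) \<subseteq> T" using iso by (auto simp: partial_iso_def)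
    have "from_nat_into T n \<in> Range (\<Union>n. P n)" for n using P(4)[of n] by blast
    then have "range (from_nat_into T) \<subseteq> Range (\<Union>n. P n)" by (intro image_subsetI)
    then show "T \<subseteq> Range (\<Union>n. P n)" by (simp only: T)
  qed
  ultimately show ?thesis by blast
qed

lemma dense_colored_rat:
  assumes "dense_coloring X c"
  shows "dense_colored (UNIV :: rat set) (<) c X"
proof -
  have d: "\<exists>z. c z = Y \<and> x < z \<and> z < y" if "Y \<in> X" "x < y" for x y Y
    using assms that unfolding dense_coloring_def by blast
  have "\<exists>z. c z = Y \<and> x < z" "\<exists>z. c z = Y \<and> z < x" if "Y \<in> X" for x Y
    using d[OF that, of x "x + 1"] d[OF that, of "x - 1" x] by auto
  moreover have "range c \<subseteq> X" using assms by (simp add: dense_coloring_def)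
  ultimately show ?thesis using d unfolding dense_colored_def by (intro conjI) (simp_all, fastforce+)
qed

lemma dense_colored_iso_rat:
  assumes D: "dense_colored S lt col X" and c: "dense_coloring X c"
  shows "\<exists>\<theta>. \<theta> ` S = UNIV \<and> (\<forall>x\<in>S. c (\<theta> x) = col x) \<and> (\<forall>x\<in>S. \<forall>y\<in>S. lt x y \<longleftrightarrow> \<theta> x < \<theta> y)"
proof -
  obtain p where p: "partial_iso S lt col UNIV (<) c p" and dom: "Domain p = S" and ran: "Range p = UNIV"
    using partial_iso_back_and_forth[OF D dense_colored_rat[OF c]] by blast
  have "\<forall>x\<in>S. \<exists>q. (x, q) \<in> p" using dom by blast
  then obtain \<theta> where \<theta>: "\<And>x. x \<in> S \<Longrightarrow> (x, \<theta> x) \<in> p" by metis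
  have "q \<in> \<theta> ` S" for q
  proof -
    obtain x where x: "(x, q) \<in> p" using ran by blast
    then have "x \<in> S" using dom by blast
    \<comment> \<open>Both rationals are partners of \<open>x\<close>, so neither is below the
      other; linearity makes them equal.\<close>
    have "q = \<theta> x"
      using partial_isoD(4)[OF p x \<theta>[OF \<open>x \<in> S\<close>]] partial_isoD(4)[OF p x x]
        partial_isoD(4)[OF p \<theta>[OF \<open>x \<in> S\<close>] x] by auto
    then show ?thesis using \<open>x \<in> S\<close> by blast
  qed
  then have "\<theta> ` S = UNIV" by blast
  moreover have "\<forall>x\<in>S. c (\<theta> x) = col x" using partial_isoD(3)[OF p \<theta>] by simp
  moreover have "\<forall>x\<in>S. \<forall>y\<in>S. lt x y \<longleftrightarrow> \<theta> x < \<theta> y" using partial_isoD(4)[OF p \<theta> \<theta>] by blast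
  ultimately show ?thesis by blast
qed

subsection \<open>Fractions colored by their last digit\<close>

text \<open>\<open>j + 1\<close> is a non-zero digit, so the right-hand side is not divisible by
  \<open>B\<close>; this excludes \<open>d > 0\<close>. For \<open>d = 0\<close> compare residues
  modulo \<open>B\<close>.\<close>

lemma last_digit_inj_aux:
  fixes v w i j :: int
  assumes "1 < B" "0 \<le> i" "i + 1 < B" "0 \<le> j" "j + 1 < B"
    and "(B * v + i + 1) * B ^ d = B * w + j + 1"
  shows "d = 0 \<and> v = w \<and> i = j"
proof -
  have "d = 0"
  proof (rule ccontr)
    assume "d \<noteq> 0"
    then have "B dvd B ^ d" by simp
    then have "B dvd B * w + (j + 1)" using assms(6) by (metis add.assoc dvd_mult)
    then have "B dvd j + 1" by (simp add: dvd_add_right_iff)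
    then show False using assms zdvd_imp_le[of B "j + 1"] by simp
  qed
  moreover from this have eq: "B * v + (i + 1) = B * w + (j + 1)" using assms(6) by simp
  from arg_cong[OF this, of "\<lambda>x. x mod B"] have "(i + 1) mod B = (j + 1) mod B"
    by (simp only: mod_mult_self4)
  then have "i = j" using assms by (simp add: mod_pos_pos_trivial)
  ultimately show ?thesis using eq assms(1) by simp
qed

lemma last_digit_inj:
  fixes v w i j :: int
  assumes "1 < B" "0 \<le> i" "i + 1 < B" "0 \<le> j" "j + 1 < B"
    and eq: "of_int (B * v + i + 1) / of_int B ^ e = (of_int (B * w + j + 1) / of_int B ^ f :: rat)"
  shows "e = f \<and> v = w \<and> i = j"
proof -
  have B: "(of_int B :: rat) \<noteq> 0" using assms(1) by simp
  have eq': "of_int ((B * v + i + 1) * B ^ f) = (of_int ((B * w + j + 1) * B ^ e) :: rat)"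
    using eq B by (simp add: field_simps)
  then have eq': "(B * v + i + 1) * B ^ f = (B * w + j + 1) * B ^ e" by (simp only: of_int_eq_iff)
  show ?thesis
  proof (cases "e \<le> f")
    case True
    then have "B ^ f = B ^ (f - e) * B ^ e" by (simp flip: power_add)
    then have "(B * v + i + 1) * B ^ (f - e) = B * w + j + 1" using eq' assms(1) by (simp add: mult.assoc[symmetric])
    from last_digit_inj_aux[OF assms(1-5) this] True show ?thesis by simp
  next
    case False
    then have "B ^ e = B ^ (e - f) * B ^ f" by (simp flip: power_add)
    then have "(B * w + j + 1) * B ^ (e - f) = B * v + i + 1" using eq' assms(1) by (simp add: mult.assoc[symmetric])
    from last_digit_inj_aux[OF assms(1,4,5,2,3) this] False show ?thesis by simp
  qed
qed

text \<open>Numerators with a fixed last digit recur with period \<open>B\<close>, so a large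
  denominator \<open>B ^ n\<close> suffices. The last clause allows \<open>v\<close> to be coded as
  a natural number.\<close>

lemma last_digit_dense:
  fixes x y :: rat and B i :: int
  assumes "1 < B" "0 \<le> i" "i + 1 < B" "x < y"
  shows "\<exists>e v. x < of_int (B * v + i + 1) / of_int B ^ e \<and> of_int (B * v + i + 1) / of_int B ^ e < y \<and> (0 \<le> x \<longrightarrow> 0 \<le> v)"
proof -
  define b where "b = (of_int B :: rat)"
  have b: "1 < b" using assms(1) by (simp add: b_def)
  \<comment> \<open>The interval is stretched to length above \<open>2 * b\<close>: one
    \<open>b\<close> for rounding up to a multiple of \<open>b\<close>, the other for adding the
    digit.\<close>
  obtain n :: nat where n: "2 * b / (y - x) < of_nat n" using reals_Archimedean2 by blast
  have ipos: "0 \<le> (of_int i :: rat)" "of_int i + 1 \<le> b"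
    using assms(2,3) unfolding b_def by (simp, metis (mono_tags) less_imp_le of_int_1 of_int_add of_int_le_iff)
  have "n < nat B ^ n" using assms(1) by (intro power_gt_expt) auto
  then have "(of_nat n :: rat) < of_nat (nat B ^ n)" by (simp only: of_nat_less_iff)
  also have "of_nat (nat B ^ n) = b ^ n" using assms(1) by (simp add: b_def)
  finally have "2 * b / (y - x) < b ^ n" using n by simp
  then have gap: "2 * b < b ^ n * (y - x)" using assms(4) by (simp add: field_simps)
  define v where "v = \<lfloor>x * b ^ n / b\<rfloor> + 1"
  have "x * b ^ n / b < of_int v" "of_int v \<le> x * b ^ n / b + 1" unfolding v_def by linarith+
  then have v: "x * b ^ n < b * of_int v" "b * of_int v \<le> x * b ^ n + b" using b by (simp_all add: field_simps)
  have "x * b ^ n < b * of_int v + of_int i + 1" "b * of_int v + of_int i + 1 < y * b ^ n"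
    using v ipos gap by (simp_all add: algebra_simps)
  then have "x < of_int (B * v + i + 1) / b ^ n" "of_int (B * v + i + 1) / b ^ n < y"
    using b by (simp_all add: field_simps b_def[symmetric])
  moreover have "0 \<le> v" if "0 \<le> x"
  proof -
    have "0 \<le> x * b ^ n / b" using that b by simp
    then show ?thesis by (simp add: v_def le_floor_iff)
  qed
  ultimately show ?thesis unfolding b_def by blast
qed

text \<open>\<open>shuffle\<close> chooses its coloring with \<open>SOME\<close>, so one has to
  exist. A rational with a finite expansion in base \<open>N + 2\<close> is colored by its last
  non-zero digit, and the remaining ones get the default color \<open>Y 0\<close>. Repetitions among
  the \<open>Y i\<close> are allowed.\<close>

lemma dense_coloring_exists: "\<exists>c. dense_coloring (Y ` {..N :: nat}) c"
proof -
  define B where "B = int N + 2"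
  define P where "P q i \<longleftrightarrow> i \<le> N \<and> (\<exists>e v. q = of_int (B * v + int i + 1) / of_int B ^ e)" for q :: rat and i
  define c where "c q = Y (if \<exists>i. P q i then (THE i. P q i) else 0)" for q
  have unique: "i = j" if "P q i" "P q j" for q i j
    using that last_digit_inj[of B "int i" "int j"] by (auto simp: P_def B_def)
  have the: "(THE i. P q i) = i" if "P q i" for q i
    using that unique by (intro the_equality)
  have c_eq: "c q = Y i" if "P q i" for q i
    using that the[OF that] by (auto simp: c_def)
  have "dense_coloring (Y ` {..N}) c"
    unfolding dense_coloring_def
  proof (intro conjI ballI allI impI)
    show "range c \<subseteq> Y ` {..N}"
    proof
      fix y assume "y \<in> range c"
      then obtain q where q: "y = c q" by blast
      show "y \<in> Y ` {..N}"
      proof (cases "\<exists>i. P q i")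
        case True
        then obtain i where i: "P q i" ..
        then have "i \<le> N" by (simp add: P_def)
        then show ?thesis using c_eq[OF i] q by blast
      qed (simp add: q c_def)
    qed
    fix y and a b :: rat assume "y \<in> Y ` {..N}" "a < b"
    then obtain i where i: "i \<le> N" "y = Y i" by auto
    obtain e v where "a < of_int (B * v + int i + 1) / of_int B ^ e" "of_int (B * v + int i + 1) / of_int B ^ e < b"
      using last_digit_dense[of B "int i" a b] i \<open>a < b\<close> by (auto simp: B_def)
    moreover have "P (of_int (B * v + int i + 1) / of_int B ^ e) i" using i by (auto simp: P_def)
    ultimately show "\<exists>q. a < q \<and> q < b \<and> c q = y" using c_eq i(2) by metis
  qed
  then show ?thesis by (rule exI[of _ c])
qed

subsection \<open>Order isomorphisms\<close>

definition rank :: "'a rel \<Rightarrow> 'a \<Rightarrow> nat" where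
  "rank r x = card {y. (y, x) \<in> r}"

text \<open>Ranks increase strictly along the order, and below an element of rank
  \<open>Suc n\<close> there is one of rank \<open>n\<close>; an infinite set of ranks closed
  downwards is everything.\<close>

lemma rank_omega:
  assumes lin: "is_linear_order (L, r)" and inf: "infinite L" and fin: "\<And>x. x \<in> L \<Longrightarrow> finite {y. (y, x) \<in> r}"
  shows "bij_betw (rank r) L UNIV" "x \<in> L \<Longrightarrow> y \<in> L \<Longrightarrow> (x, y) \<in> r \<longleftrightarrow> rank r x < rank r y"
proof -
  have sub: "r \<subseteq> L \<times> L" and trans: "trans r" and irrefl: "irrefl r" and total: "total_on L r"
    using lin by (auto simp: strict_linear_order_on_def)
  have less: "rank r x < rank r y" if "(x, y) \<in> r" for x y
    unfolding rank_def
  proof (rule psubset_card_mono)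
    show "finite {z. (z, y) \<in> r}" using fin sub that by blast
    show "{z. (z, x) \<in> r} \<subset> {z. (z, y) \<in> r}"
      using that transD[OF trans] irrefl by (auto simp: irrefl_def)
  qed
  show iff: "(x, y) \<in> r \<longleftrightarrow> rank r x < rank r y" if "x \<in> L" "y \<in> L" for x y
    using less[of x y] less[of y x] total that by (fastforce simp: total_on_def)
  have inj: "inj_on (rank r) L"
    using iff total by (auto simp: inj_on_def total_on_def) (metis less_irrefl)
  have below: "m \<in> rank r ` L" if "x \<in> L" "rank r x = n" "m \<le> n" for m n x
    using that
  proof (induction n arbitrary: x)
    case 0
    then show ?case by auto
  next
    case (Suc n)
    let ?P = "{y. (y, x) \<in> r}"
    have card: "card ?P = Suc n" using Suc.prems by (simp add: rank_def)
    have P: "finite ?P" "?P \<noteq> {}" "?P \<subseteq> L" using fin Suc.prems(1) card sub by (blast, force, blast)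
    \<comment> \<open>The predecessor of greatest rank is the immediate one: every other predecessor
      of \<open>x\<close> lies below it.\<close>
    then have "Max (rank r ` ?P) \<in> rank r ` ?P" by (intro Max_in) auto
    then obtain y where y': "y \<in> ?P" "Max (rank r ` ?P) = rank r y" by (rule imageE)
    then have y: "y \<in> ?P" "\<forall>z\<in>?P. rank r z \<le> rank r y" using P(1) by (auto simp flip: y'(2))
    have "{z. (z, x) \<in> r} = insert y {z. (z, y) \<in> r}"
    proof (intro set_eqI iffI)
      fix z assume z: "z \<in> {z. (z, x) \<in> r}"
      then have "\<not> (y, z) \<in> r" using y(2) less[of y z] by force
      moreover have "z \<in> L" "y \<in> L" using z y(1) P(3) by blast+
      ultimately show "z \<in> insert y {z. (z, y) \<in> r}" using total by (auto simp: total_on_def)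
    next
      fix z assume "z \<in> insert y {z. (z, y) \<in> r}"
      then show "z \<in> {z. (z, x) \<in> r}" using y(1) transD[OF trans] by auto
    qed
    moreover have "finite {z. (z, y) \<in> r}" "(y, y) \<notin> r" using fin y(1) P(3) irrefl by (blast, simp add: irrefl_def)
    ultimately have "rank r x = Suc (rank r y)" by (simp add: rank_def)
    then have "rank r y = n" and "y \<in> L" using Suc.prems y P(3) by auto
    show ?case
    proof (cases "m = Suc n")
      case True
      then show ?thesis using Suc.prems(1,2) by (metis image_eqI)
    next
      case False
      then have "m \<le> n" using Suc.prems(3) by simp
      then show ?thesis using Suc.IH[of y] \<open>y \<in> L\<close> \<open>rank r y = n\<close> by simp
    qed
  qed
  have "m \<in> rank r ` L" for m
  proof -
    have "infinite (rank r ` L)" using inf inj by (simp add: finite_image_iff)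
    then obtain n where "n \<in> rank r ` L" "m \<le> n" by (meson infinite_nat_iff_unbounded_le)
    then show ?thesis using below by blast
  qed
  then show "bij_betw (rank r) L UNIV" using inj by (auto simp: bij_betw_def)
qed

text \<open>Reduces an isomorphism on classes to a relation \<open>R\<close> between representatives
  and points of the target, so that later arguments never mention the quotient.\<close>

lemma cohesive_power_isoI:
  assumes total: "\<And>\<phi>. \<phi> \<in> power_functions C L \<Longrightarrow> \<exists>y\<in>B. R \<phi> y"
    and onto: "\<And>y. y \<in> B \<Longrightarrow> \<exists>\<phi>\<in>power_functions C L. R \<phi> y"
    and eq: "\<And>\<phi> \<psi> y z. \<phi> \<in> power_functions C L \<Longrightarrow> \<psi> \<in> power_functions C L \<Longrightarrow> y \<in> B \<Longrightarrow> z \<in> B \<Longrightarrow>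
      R \<phi> y \<Longrightarrow> R \<psi> z \<Longrightarrow> (\<phi>, \<psi>) \<in> power_eq C L \<longleftrightarrow> y = z"
    and less: "\<And>\<phi> \<psi> y z. \<phi> \<in> power_functions C L \<Longrightarrow> \<psi> \<in> power_functions C L \<Longrightarrow> y \<in> B \<Longrightarrow> z \<in> B \<Longrightarrow>
      R \<phi> y \<Longrightarrow> R \<psi> z \<Longrightarrow>
      C \<subseteq>\<^sup>* {x. \<exists>u v. \<phi> x = Some u \<and> \<psi> x = Some v \<and> (u, v) \<in> r} \<longleftrightarrow> (y, z) \<in> s"
  shows "order_isomorphic (cohesive_power C (L, r)) (B, s)"
proof -
  let ?F = "power_functions C L" and ?E = "power_eq C L"
  obtain h where h: "\<And>\<phi>. \<phi> \<in> ?F \<Longrightarrow> h \<phi> \<in> B \<and> R \<phi> (h \<phi>)" using total by metis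
  have h_eq: "(\<phi>, \<psi>) \<in> ?E \<longleftrightarrow> h \<phi> = h \<psi>" if "\<phi> \<in> ?F" "\<psi> \<in> ?F" for \<phi> \<psi>
    using eq[OF that] h that by blast
  have dom: "\<phi> \<in> ?F" "\<psi> \<in> ?F" if "(\<phi>, \<psi>) \<in> ?E" for \<phi> \<psi> using that by (auto simp: power_eq_def)
  have cls: "?E `` {\<phi>} = {\<psi> \<in> ?F. h \<psi> = h \<phi>}" if "\<phi> \<in> ?F" for \<phi>
    using h_eq[OF that] dom(2)[of \<phi>] by (intro set_eqI) (simp only: Image_singleton_iff mem_Collect_eq, metis)
  define f where "f K = h (SOME \<phi>. \<phi> \<in> K)" for K
  have f: "f (?E `` {\<phi>}) = h \<phi>" if "\<phi> \<in> ?F" for \<phi>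
    using someI[of "\<lambda>\<psi>. \<psi> \<in> ?E `` {\<phi>}" \<phi>] that unfolding f_def cls[OF that] by simp
  have "bij_betw f (?F // ?E) B"
    unfolding bij_betw_def
  proof
    show "inj_on f (?F // ?E)"
    proof (rule inj_onI)
      fix K K' assume "K \<in> ?F // ?E" "K' \<in> ?F // ?E" and eq: "f K = f K'"
      then obtain \<phi> \<psi> where \<phi>\<psi>: "\<phi> \<in> ?F" "\<psi> \<in> ?F" "K = ?E `` {\<phi>}" "K' = ?E `` {\<psi>}"
        by (auto simp: quotient_def)
      then have "h \<phi> = h \<psi>" using eq f by metis
      then show "K = K'" using \<phi>\<psi> by (simp add: cls)
    qed
    show "f ` (?F // ?E) = B"
    proof
      show "f ` (?F // ?E) \<subseteq> B" using f h by (auto simp: quotient_def)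
      show "B \<subseteq> f ` (?F // ?E)"
      proof
        fix y assume y: "y \<in> B"
        then obtain \<phi> where \<phi>: "\<phi> \<in> ?F" "R \<phi> y" using onto by blast
        have "(\<phi>, \<phi>) \<in> ?E" using h_eq \<phi> by blast
        then have "h \<phi> = y" using eq[OF \<phi>(1) \<phi>(1), of "h \<phi>" y] h y \<phi> by blast
        then show "y \<in> f ` (?F // ?E)" using f[OF \<phi>(1)] quotientI[OF \<phi>(1), of ?E] by (metis imageI)
      qed
    qed
  qed
  moreover have "(K, K') \<in> snd (cohesive_power C (L, r)) \<longleftrightarrow> (f K, f K') \<in> s"
    if "K \<in> ?F // ?E" "K' \<in> ?F // ?E" for K K'
  proof -
    obtain \<phi> \<psi> where \<phi>\<psi>: "\<phi> \<in> ?F" "\<psi> \<in> ?F" "K = ?E `` {\<phi>}" "K' = ?E `` {\<psi>}"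
      using \<open>K \<in> ?F // ?E\<close> \<open>K' \<in> ?F // ?E\<close> by (auto simp: quotient_def)
    show ?thesis
    proof
      assume "(K, K') \<in> snd (cohesive_power C (L, r))"
      then obtain \<phi>' \<psi>' where *: "\<phi>' \<in> ?F" "\<psi>' \<in> ?F" "K = ?E `` {\<phi>'}" "K' = ?E `` {\<psi>'}"
        "C \<subseteq>\<^sup>* {x. \<exists>u v. \<phi>' x = Some u \<and> \<psi>' x = Some v \<and> (u, v) \<in> r}" by auto
      then show "(f K, f K') \<in> s" using less[OF *(1,2)] h f by metis
    next
      assume "(f K, f K') \<in> s"
      then have "C \<subseteq>\<^sup>* {x. \<exists>u v. \<phi> x = Some u \<and> \<psi> x = Some v \<and> (u, v) \<in> r}"
        using less[OF \<phi>\<psi>(1,2)] h f \<phi>\<psi> by metis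
      then show "(K, K') \<in> snd (cohesive_power C (L, r))" using \<phi>\<psi> by auto
    qed
  qed
  ultimately show ?thesis by auto
qed

subsection \<open>The computable linear order\<close>

text \<open>A point \<open>a = \<langle>\<langle>e, v\<rangle>, i\<rangle>\<close> stands for the fraction \<open>(B v + i + 1) / B ^ e\<close> in base \<open>B = N + 2\<close>; its
  color \<open>i \<le> N\<close> is read off the last digit, which is not zero, so that distinct points stand for
  distinct fractions. An element \<open>\<langle>a, \<langle>s, j\<rangle>\<rangle>\<close> of the order is the \<open>j\<close>-th element of the block replacing
  \<open>a\<close>, where \<open>s\<close> is the stage at which \<open>a\<close> enters the c.e. set of points; recording \<open>s\<close> makes the
  carrier computable.\<close>

locale block_order = cohesive_set +
  fixes N :: nat and k :: "nat \<Rightarrow> nat"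
  assumes k_pos: "i \<le> N \<Longrightarrow> k i \<noteq> 0"
begin

definition col :: "nat \<Rightarrow> nat" where "col a = psnd a"
definition num :: "nat \<Rightarrow> nat" where "num a = (N + 2) * psnd (pfst a) + col a + 1"
definition den :: "nat \<Rightarrow> nat" where "den a = (N + 2) ^ pfst (pfst a)"
definition pos :: "nat \<Rightarrow> rat" where "pos a = of_nat (num a) / of_nat (den a)"
text \<open>The integer part of \<open>pos a\<close>. Tending to infinity along \<open>C\<close> is
  expressed through it, since the growth lemmas concern functions with natural values.\<close>

definition ht :: "nat \<Rightarrow> nat" where "ht a = num a div den a"

lemma den_pos [simp]: "0 < den a"
  by (simp add: den_def)

lemma pos_less_iff: "pos a < pos b \<longleftrightarrow> num a * den b < num b * den a"
proof -
  have "pos a < pos b \<longleftrightarrow> (of_nat (num a) * of_nat (den b) :: rat) < of_nat (num b) * of_nat (den a)"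
    by (simp add: pos_def divide_simps)
  also have "\<dots> \<longleftrightarrow> num a * den b < num b * den a" by (simp only: of_nat_mult[symmetric] of_nat_less_iff)
  finally show ?thesis .
qed

text \<open>Used with \<open>c = 1\<close> for the integer part and with \<open>c = 2\<close> for
  membership in \<open>points\<close>.\<close>

lemma of_nat_le_mult_pos: "of_nat q \<le> of_nat c * pos a \<longleftrightarrow> q * den a \<le> c * num a"
proof -
  have "of_nat q \<le> of_nat c * pos a \<longleftrightarrow> (of_nat q * of_nat (den a) :: rat) \<le> of_nat c * of_nat (num a)"
    by (simp add: pos_def divide_simps)
  also have "\<dots> \<longleftrightarrow> q * den a \<le> c * num a" by (simp only: of_nat_mult[symmetric] of_nat_le_iff)
  finally show ?thesis .
qed

lemma ht_le_iff: "q \<le> ht a \<longleftrightarrow> of_nat q \<le> pos a"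
  using of_nat_le_mult_pos[of q 1 a] by (simp add: ht_def less_eq_div_iff_mult_less_eq)

lemma of_nat_ht_le: "of_nat (ht a) \<le> pos a"
  by (simp flip: ht_le_iff)

lemma pos_less_Suc_ht: "pos a < of_nat (Suc (ht a))"
  using ht_le_iff[of "Suc (ht a)" a] by linarith

lemma pos_eq: "pos a = of_int ((int N + 2) * int (psnd (pfst a)) + int (col a) + 1) / of_int (int N + 2) ^ pfst (pfst a)"
  by (simp add: pos_def num_def den_def algebra_simps)

lemma pos_inj:
  assumes "col a \<le> N" "col b \<le> N" "pos a = pos b"
  shows "a = b"
proof -
  have "pfst (pfst a) = pfst (pfst b) \<and> int (psnd (pfst a)) = int (psnd (pfst b)) \<and> int (col a) = int (col b)"
    by (rule last_digit_inj[of "int N + 2"]) (use assms in \<open>auto simp: pos_eq\<close>)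
  then show ?thesis by (metis col_def of_nat_eq_iff prod.collapse prod_decode_inverse)
qed

lemma pos_dense:
  assumes "i \<le> N" "0 \<le> x" "x < y"
  shows "\<exists>a. col a = i \<and> x < pos a \<and> pos a < y"
proof -
  obtain e v where v: "x < of_int ((int N + 2) * v + int i + 1) / of_int (int N + 2) ^ e"
    "of_int ((int N + 2) * v + int i + 1) / of_int (int N + 2) ^ e < y" "0 \<le> v"
    using last_digit_dense[of "int N + 2" "int i" x y] assms by auto
  then have "pos (pr (pr e (nat v)) i) = of_int ((int N + 2) * v + int i + 1) / of_int (int N + 2) ^ e"
    by (simp add: pos_eq col_def)
  then show ?thesis using v by (intro exI[of _ "pr (pr e (nat v)) i"]) (simp add: col_def)
qed

lemma pos_nonneg: "0 \<le> pos a"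
  by (simp add: pos_def)

lemma computable_col [cintros]: "computable f \<Longrightarrow> computable (\<lambda>n. col (f n))"
  unfolding col_def by (intro cintros)

lemma computable_num [cintros]: "computable f \<Longrightarrow> computable (\<lambda>n. num (f n))"
  unfolding num_def by (intro cintros)

lemma computable_den [cintros]: "computable f \<Longrightarrow> computable (\<lambda>n. den (f n))"
  unfolding den_def by (intro cintros)

lemma decidable_pos_less [cintros]:
  "computable f \<Longrightarrow> computable g \<Longrightarrow> decidable (\<lambda>n. pos (f n) < pos (g n))"
  unfolding pos_less_iff by (intro cintros)

lemma computable_ht [cintros]:
  assumes "computable f" shows "computable (\<lambda>n. ht (f n))"
proof -
  \<comment> \<open>Division is obtained as a search for the quotient.\<close>
  have eq: "(LEAST t. num a < Suc t * den a) = ht a" for a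
  proof (rule Least_equality)
    show "num a < Suc (ht a) * den a"
      using div_mult_mod_eq[of "num a" "den a"] mod_less_divisor[OF den_pos, of "num a" a]
      unfolding ht_def mult_Suc by linarith
    show "ht a \<le> t" if "num a < Suc t * den a" for t
      using that unfolding ht_def by (metis less_Suc_eq_le less_mult_imp_div_less)
  qed
  have "computable (\<lambda>n. LEAST t. num (f n) < Suc t * den (f n))"
  proof (intro cintros computable_comp[OF assms])
    show "\<exists>t. num (f n) < Suc t * den (f n)" for n
      using mult_le_mono2[of 1 "den (f n)" "Suc (num (f n))"] by (intro exI[of _ "num (f n)"]) (simp add: Suc_le_eq)
  qed
  then show ?thesis by (simp only: eq)
qed

section \<open>The c.e. set of points and its stages\<close>

text \<open>The factor \<open>2\<close> absorbs the additive constant in the bound of \<open>card_below_bound\<close>.\<close>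

definition points :: "nat set" where
  "points = {a. col a \<le> N \<and> of_nat (card (C \<inter> {..a})) \<le> 2 * pos a}"

text \<open>The condition of \<open>points\<close> with \<open>Cs s\<close> in place of
  \<open>C\<close>, multiplied out to natural numbers. Since \<open>Cs s\<close> shrinks, a point
  that has entered stays.\<close>

definition entered :: "nat \<Rightarrow> nat \<Rightarrow> bool" where
  "entered a s \<longleftrightarrow> card (Cs s \<inter> {..a}) * den a \<le> 2 * num a"

definition entry :: "nat \<Rightarrow> nat" where
  "entry a = (LEAST s. entered a s)"

lemma entered_mono: "entered a s \<Longrightarrow> s \<le> t \<Longrightarrow> entered a t"
proof -
  assume "entered a s" "s \<le> t"
  have "card (Cs t \<inter> {..a}) \<le> card (Cs s \<inter> {..a})"
    using Cs_antimono[OF \<open>s \<le> t\<close>] by (intro card_mono) auto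
  then have "card (Cs t \<inter> {..a}) * den a \<le> card (Cs s \<inter> {..a}) * den a" by (rule mult_right_mono) simp
  with \<open>entered a s\<close> show ?thesis unfolding entered_def by linarith
qed

lemma points_iff: "a \<in> points \<longleftrightarrow> col a \<le> N \<and> (\<exists>s. entered a s)"
proof -
  have *: "of_nat (card (C \<inter> {..a})) \<le> 2 * pos a \<longleftrightarrow> card (C \<inter> {..a}) * den a \<le> 2 * num a"
    using of_nat_le_mult_pos[of _ 2] by simp
  have "card (C \<inter> {..a}) * den a \<le> 2 * num a \<longleftrightarrow> (\<exists>s. entered a s)"
  proof
    assume **: "card (C \<inter> {..a}) * den a \<le> 2 * num a"
    obtain s where "\<forall>m\<le>a. m \<in> Cs s \<longleftrightarrow> m \<in> C" using Cs_agree by blast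
    then have "Cs s \<inter> {..a} = C \<inter> {..a}" by auto
    then show "\<exists>s. entered a s" using ** by (intro exI[of _ s]) (simp add: entered_def)
  next
    assume "\<exists>s. entered a s"
    then obtain s where s: "entered a s" ..
    have "card (C \<inter> {..a}) \<le> card (Cs s \<inter> {..a})" using C_subset_Cs[of s] by (intro card_mono) auto
    then have "card (C \<inter> {..a}) * den a \<le> card (Cs s \<inter> {..a}) * den a" by (rule mult_right_mono) simp
    with s show "card (C \<inter> {..a}) * den a \<le> 2 * num a" unfolding entered_def by linarith
  qed
  with * show ?thesis by (simp add: points_def)
qed

text \<open>The left-hand side is decidable: a claimed entry stage is verified by looking at
  \<open>s\<close> and \<open>s - 1\<close> only. This makes \<open>carrier\<close> computable. The
  case \<open>s = 0\<close> is separate because subtraction is truncated.\<close>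

lemma entry_eq_iff: "entered a s \<and> (s = 0 \<or> \<not> entered a (s - 1)) \<longleftrightarrow> (\<exists>s. entered a s) \<and> s = entry a"
proof
  assume *: "entered a s \<and> (s = 0 \<or> \<not> entered a (s - 1))"
  have "entry a = s"
    unfolding entry_def
  proof (rule Least_equality)
    show "s \<le> t" if "entered a t" for t
    proof (rule ccontr)
      assume "\<not> s \<le> t"
      then have "t \<le> s - 1" "s \<noteq> 0" by auto
      then show False using * entered_mono[OF that] by blast
    qed
  qed (use * in blast)
  with * show "(\<exists>s. entered a s) \<and> s = entry a" by auto
next
  assume "(\<exists>s. entered a s) \<and> s = entry a"
  then show "entered a s \<and> (s = 0 \<or> \<not> entered a (s - 1))"
    using LeastI_ex[of "entered a"] not_less_Least[of "s - 1" "entered a"] by (cases s) (auto simp: entry_def)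
qed

lemma decidable_entered [cintros]:
  assumes "computable f" "computable g" shows "decidable (\<lambda>n. entered (f n) (g n))"
proof -
  have eq: "card (Cs s \<inter> {..a}) = (\<Sum>i<Suc a. of_bool (i \<in> Cs s))" for a s
    by (simp add: lessThan_Suc_atMost Int_commute Int_def)
  show ?thesis
    unfolding entered_def eq by (intro cintros assms computable_comp[OF assms(2)])
qed

text \<open>\<open>C\<close> has more than \<open>2 * q\<close> elements below some
  \<open>t\<close>, and beyond \<open>t\<close> a fraction of position at most \<open>q\<close> no
  longer meets the threshold.\<close>

lemma finite_points_below: "finite {a \<in> points. pos a \<le> q}"
proof -
  obtain m :: nat where m: "2 * q < of_nat m" using reals_Archimedean2 by blast
  obtain T where T: "T \<subseteq> C" "card T = m" "finite T"
    using infinite_arbitrarily_large[of C m] cohesive by (auto simp: cohesive_def)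
  then obtain t where t: "T \<subseteq> {..t}" by (metis finite_nat_iff_bounded_le)
  have "{a \<in> points. pos a \<le> q} \<subseteq> {..t}"
  proof
    fix a assume a: "a \<in> {a \<in> points. pos a \<le> q}"
    show "a \<in> {..t}"
    proof (rule ccontr)
      assume "a \<notin> {..t}"
      then have "card T \<le> card (C \<inter> {..a})" using T t by (intro card_mono) auto
      moreover have "(of_nat (card (C \<inter> {..a})) :: rat) \<le> 2 * q" using a by (auto simp: points_def)
      moreover have "(of_nat (card T) :: rat) \<le> of_nat (card (C \<inter> {..a}))"
        using \<open>card T \<le> card (C \<inter> {..a})\<close> by simp
      ultimately show False using m T(2) by simp
    qed
  qed
  then show ?thesis by (rule finite_subset) simp
qed

text \<open>\<open>card_C_bound\<close> for the jump from \<open>n\<close> to the code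
  \<open>r n\<close>, with the height of \<open>r n\<close> as the growing function.\<close>

lemma eventually_points:
  assumes r: "computable r" and lim: "filterlim (\<lambda>n. ht (r n)) at_top U" and col: "eventually (\<lambda>n. col (r n) \<le> N) U"
  shows "eventually (\<lambda>n. r n \<in> points) U"
  using card_C_bound[OF r computable_ht[OF r] lim] col
proof eventually_elim
  case (elim n)
  then have "(of_nat (card (C \<inter> {..r n})) :: rat) \<le> of_nat (2 * ht (r n))" by (simp only: of_nat_le_iff)
  also have "\<dots> \<le> 2 * pos (r n)" using of_nat_ht_le[of "r n"] by simp
  finally show ?case using elim by (simp add: points_def)
qed

section \<open>The carrier and its order\<close>

definition elt :: "nat \<Rightarrow> nat \<Rightarrow> nat" where
  "elt a j = pr a (pr (entry a) j)"

definition block :: "nat \<Rightarrow> nat" where "block x = pfst x"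
definition offset :: "nat \<Rightarrow> nat" where "offset x = psnd (psnd x)"

lemma block_elt [simp]: "block (elt a j) = a" and offset_elt [simp]: "offset (elt a j) = j"
  by (simp_all add: block_def offset_def elt_def)

definition carrier :: "nat set" where
  "carrier = {x. block x \<in> points \<and> offset x < k (col (block x)) \<and> x = elt (block x) (offset x)}"

definition rel :: "nat rel" where
  "rel = {(x, y). x \<in> carrier \<and> y \<in> carrier \<and>
     (pos (block x) < pos (block y) \<or> block x = block y \<and> offset x < offset y)}"

lemma elt_in_carrier [simp]: "elt a j \<in> carrier \<longleftrightarrow> a \<in> points \<and> j < k (col a)"
  by (simp add: carrier_def)

lemma computable_block [cintros]: "computable f \<Longrightarrow> computable (\<lambda>n. block (f n))"
  unfolding block_def by (intro cintros)

lemma computable_offset [cintros]: "computable f \<Longrightarrow> computable (\<lambda>n. offset (f n))"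
  unfolding offset_def by (intro cintros)

text \<open>The guard \<open>f n \<le> N\<close> confines the arbitrary function \<open>k\<close> to
  a finite table.\<close>

lemma decidable_less_k [cintros]:
  assumes "computable f" "computable g"
  shows "decidable (\<lambda>n. f n \<le> N \<and> g n < k (f n))"
proof -
  have "computable (\<lambda>n. if f n \<le> N then k (f n) else 0)"
    using computable_comp[OF computable_finite_support assms(1)] .
  then have "decidable (\<lambda>n. g n < (if f n \<le> N then k (f n) else 0))"
    by (rule decidable_less[OF assms(2)])
  then show ?thesis by (rule back_subst[of decidable]) auto
qed

lemma decidable_carrier [cintros]:
  assumes "computable f"
  shows "decidable (\<lambda>n. f n \<in> carrier)"
proof -
  have eq: "x \<in> carrier \<longleftrightarrow> (col (block x) \<le> N \<and> offset x < k (col (block x))) \<and>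
      entered (block x) (pfst (psnd x)) \<and> (pfst (psnd x) = 0 \<or> \<not> entered (block x) (pfst (psnd x) - 1))" for x
  proof -
    have "x = elt (block x) (offset x) \<longleftrightarrow> pfst (psnd x) = entry (block x)"
      by (metis block_def elt_def fst_conv offset_def prod.collapse prod_decode_inverse prod_encode_inverse snd_conv)
    then show ?thesis unfolding entry_eq_iff carrier_def points_iff by blast
  qed
  show ?thesis unfolding eq by (intro cintros assms)
qed

lemma is_linear_order: "is_linear_order (carrier, rel)"
proof -
  have "trans rel" by (rule transI) (auto simp: rel_def)
  moreover have "irrefl rel" by (auto simp: irrefl_def rel_def)
  moreover have "total_on carrier rel"
  proof (rule total_onI)
    fix x y assume xy: "x \<in> carrier" "y \<in> carrier" "x \<noteq> y"
    consider "pos (block x) < pos (block y)" | "pos (block y) < pos (block x)" | "pos (block x) = pos (block y)"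
      by linarith
    then show "(x, y) \<in> rel \<or> (y, x) \<in> rel"
    proof cases
      case 3
      then have "block x = block y" using pos_inj xy by (auto simp: carrier_def points_iff)
      moreover have "offset x \<noteq> offset y" using xy calculation by (auto simp: carrier_def)
      ultimately show ?thesis using xy by (auto simp: rel_def)
    qed (use xy in \<open>auto simp: rel_def\<close>)
  qed
  ultimately show ?thesis by (auto simp: strict_linear_order_on_def rel_def)
qed

lemma finite_rel_below:
  assumes "x \<in> carrier" shows "finite {y. (y, x) \<in> rel}"
proof (rule finite_subset)
  let ?P = "{a \<in> points. pos a \<le> pos (block x)}"
  show "{y. (y, x) \<in> rel} \<subseteq> (\<lambda>(a, j). elt a j) ` (SIGMA a:?P. {..<k (col a)})"
  proof
    fix y assume "y \<in> {y. (y, x) \<in> rel}"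
    then have "y = elt (block y) (offset y)" "(block y, offset y) \<in> (SIGMA a:?P. {..<k (col a)})"
      by (auto simp: rel_def carrier_def)
    then show "y \<in> (\<lambda>(a, j). elt a j) ` (SIGMA a:?P. {..<k (col a)})" by (auto intro: rev_image_eqI)
  qed
  show "finite ((\<lambda>(a, j). elt a j) ` (SIGMA a:?P. {..<k (col a)}))"
    using finite_points_below by (intro finite_imageI finite_SigmaI) auto
qed

text \<open>The code of \<open>v + 1 / (N + 2)\<close>: a computable fraction of color 0 strictly
  between \<open>v\<close> and \<open>v + 1\<close>.\<close>

definition line :: "nat \<Rightarrow> nat" where "line v = pr (pr 1 v) 0"

lemma pos_line: "of_nat v < pos (line v)" "pos (line v) < of_nat (Suc v)"
proof -
  have "pos (line v) = of_nat v + 1 / of_nat (N + 2)"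
    by (simp add: pos_def num_def den_def line_def col_def field_simps)
  moreover have "0 < (1 :: rat) / of_nat (N + 2)" "(1 :: rat) / of_nat (N + 2) < 1" by simp_all
  ultimately show "of_nat v < pos (line v)" "pos (line v) < of_nat (Suc v)" by simp_all
qed

lemma ht_line: "ht (line v) = v"
proof (rule antisym)
  show "v \<le> ht (line v)" using pos_line(1)[of v] by (simp add: ht_le_iff)
  have "\<not> Suc v \<le> ht (line v)" using pos_line(2)[of v] by (simp add: ht_le_iff del: of_nat_Suc)
  then show "ht (line v) \<le> v" by simp
qed

lemma computable_line [cintros]: "computable f \<Longrightarrow> computable (\<lambda>n. line (f n))"
  unfolding line_def by (intro cintros)

text \<open>\<open>line n\<close> has height \<open>n\<close> and is a point for almost all
  \<open>n\<close> in \<open>C\<close>, so the heights occurring in the carrier include almost all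
  of \<open>C\<close>.\<close>

lemma infinite_carrier: "infinite carrier"
proof
  assume fin: "finite carrier"
  have "filterlim (\<lambda>n. ht (line n)) at_top U" unfolding ht_line by (intro filterlim_U) simp
  moreover have "computable line" using computable_line[OF computable_id] .
  ultimately have "eventually (\<lambda>n. line n \<in> points) U"
    using eventually_points[of line] by (simp add: line_def col_def)
  then have "eventually (\<lambda>n. elt (line n) 0 \<in> carrier) U"
    by (rule eventually_mono) (use k_pos in \<open>auto simp: points_iff\<close>)
  then have "eventually (\<lambda>n. n \<in> (\<lambda>x. ht (block x)) ` carrier) U"
    by (rule eventually_mono) (metis block_elt ht_line image_eqI)
  moreover have "finite {n \<in> C. n \<in> (\<lambda>x. ht (block x)) ` carrier}" using fin by simp
  ultimately have "finite ({n \<in> C. n \<in> (\<lambda>x. ht (block x)) ` carrier} \<union> {n \<in> C. n \<notin> (\<lambda>x. ht (block x)) ` carrier})"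
    by (simp add: eventually_U)
  moreover have "C = {n \<in> C. n \<in> (\<lambda>x. ht (block x)) ` carrier} \<union> {n \<in> C. n \<notin> (\<lambda>x. ht (block x)) ` carrier}" by blast
  ultimately show False using cohesive by (simp add: cohesive_def)
qed

lemma computable_linear_order: "computable_linear_order (carrier, rel)"
proof -
  have "computable_set carrier" unfolding computable_set_iff by (intro cintros)
  moreover have "computable_rel rel"
    unfolding computable_rel_iff rel_def mem_Collect_eq prod.case by (intro cintros)
  moreover have "carrier \<noteq> {}" using infinite_carrier by auto
  ultimately show ?thesis using is_linear_order by simp
qed

lemma rank_bij: "bij_betw (rank rel) carrier UNIV"
  by (rule rank_omega(1)[OF is_linear_order infinite_carrier finite_rel_below])

lemma rank_less_iff: "x \<in> carrier \<Longrightarrow> y \<in> carrier \<Longrightarrow> (x, y) \<in> rel \<longleftrightarrow> rank rel x < rank rel y"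
  by (rule rank_omega(2)[OF is_linear_order infinite_carrier finite_rel_below])

lemma isomorphic_omega: "order_isomorphic (carrier, rel) omega_order"
  using rank_bij rank_less_iff by (auto simp: omega_order_def)

end

subsection \<open>The cohesive power\<close>

context block_order
begin

text \<open>Total representatives of the non-standard elements. Two of them that
  \<open>below\<close> does not distinguish agree almost everywhere on \<open>C\<close>, so the ties
  of the weak order are exactly the equalities of the power.\<close>

definition nonstandard :: "(nat \<Rightarrow> nat) set" where
  "nonstandard = {f. computable f \<and> eventually (\<lambda>n. f n \<in> points) U \<and> filterlim (\<lambda>n. ht (f n)) at_top U}"

definition below :: "(nat \<Rightarrow> nat) \<Rightarrow> (nat \<Rightarrow> nat) \<Rightarrow> bool" where
  "below f g \<longleftrightarrow> eventually (\<lambda>n. pos (f n) < pos (g n)) U"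

definition lim_col :: "(nat \<Rightarrow> nat) \<Rightarrow> nat" where
  "lim_col f = (SOME i. eventually (\<lambda>n. col (f n) = i) U)"

lemma eventually_False_U [simp]: "\<not> eventually (\<lambda>_. False) U"
  using U_neq_bot by (simp add: trivial_limit_def)

lemma eventually_const_U [simp]: "eventually (\<lambda>_. P) U \<longleftrightarrow> P"
  by (cases P) simp_all

lemma eventually_not_U: "eventually (\<lambda>n. \<not> P n) U \<Longrightarrow> \<not> eventually P U"
proof
  assume "eventually (\<lambda>n. \<not> P n) U" "eventually P U"
  then have "eventually (\<lambda>n. False) U" by eventually_elim simp
  then show False by simp
qed

text \<open>Remove the values one at a time: by cohesiveness each is taken almost everywhere on
  \<open>C\<close> or almost nowhere.\<close>

lemma eventually_constant:
  assumes f: "computable f" and K: "finite K" and ev: "eventually (\<lambda>n. f n \<in> K) U"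
  shows "\<exists>v\<in>K. eventually (\<lambda>n. f n = v) U"
  using K ev
proof (induction K rule: finite_induct)
  case (insert v K)
  have "decidable (\<lambda>n. f n = v)" by (intro cintros f)
  then consider "eventually (\<lambda>n. f n = v) U" | "eventually (\<lambda>n. f n \<noteq> v) U"
    using decidable_dichotomy by blast
  then show ?case
  proof cases
    case 2
    with insert.prems have "eventually (\<lambda>n. f n \<in> K) U" by eventually_elim blast
    then show ?thesis using insert.IH by blast
  qed blast
qed simp

lemma eventually_unique: "eventually (\<lambda>n. f n = v) U \<Longrightarrow> eventually (\<lambda>n. f n = w) U \<Longrightarrow> v = w"
proof -
  assume "eventually (\<lambda>n. f n = v) U" "eventually (\<lambda>n. f n = w) U"
  then have "eventually (\<lambda>n. v = w) U" by eventually_elim simp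
  then show ?thesis by simp
qed

lemma lim_col_eq: "eventually (\<lambda>n. col (f n) = i) U \<Longrightarrow> lim_col f = i"
  unfolding lim_col_def using eventually_unique by (intro some_equality)

lemma lim_col:
  assumes "f \<in> nonstandard"
  shows "eventually (\<lambda>n. col (f n) = lim_col f) U" "lim_col f \<le> N"
proof -
  have "eventually (\<lambda>n. col (f n) \<in> {..N}) U"
    using assms by (auto simp: nonstandard_def points_iff elim: eventually_mono)
  moreover have "computable (\<lambda>n. col (f n))" using assms by (intro cintros) (simp add: nonstandard_def)
  ultimately obtain i where "i \<in> {..N}" "eventually (\<lambda>n. col (f n) = i) U"
    using eventually_constant[of "\<lambda>n. col (f n)" "{..N}"] by auto
  then show "eventually (\<lambda>n. col (f n) = lim_col f) U" "lim_col f \<le> N" using lim_col_eq by auto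
qed

text \<open>If the height does not tend to infinity, cohesiveness bounds it almost everywhere on
  \<open>C\<close>, and only finitely many points lie below a bound.\<close>

lemma standard_or_nonstandard:
  assumes f: "computable f" and pts: "eventually (\<lambda>n. f n \<in> points) U"
  shows "f \<in> nonstandard \<or> (\<exists>a\<in>points. eventually (\<lambda>n. f n = a) U)"
proof (cases "filterlim (\<lambda>n. ht (f n)) at_top U")
  case True
  then show ?thesis using assms by (simp add: nonstandard_def)
next
  case False
  then obtain q where q: "\<not> eventually (\<lambda>n. q \<le> ht (f n)) U" by (auto simp: filterlim_at_top)
  have "decidable (\<lambda>n. q \<le> ht (f n))" by (intro cintros f)
  then have "eventually (\<lambda>n. \<not> q \<le> ht (f n)) U" using decidable_dichotomy q by blast
  with pts have "eventually (\<lambda>n. f n \<in> {a \<in> points. pos a \<le> of_nat q}) U"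
    by eventually_elim (simp add: ht_le_iff)
  then show ?thesis using eventually_constant[OF f finite_points_below] by blast
qed

lemma below_dichotomy:
  "computable f \<Longrightarrow> computable g \<Longrightarrow> below f g \<or> eventually (\<lambda>n. \<not> pos (f n) < pos (g n)) U"
  unfolding below_def by (intro decidable_dichotomy cintros)

lemma not_below_eq:
  assumes "f \<in> nonstandard" "g \<in> nonstandard" "\<not> below f g" "\<not> below g f"
  shows "eventually (\<lambda>n. f n = g n) U"
proof -
  have "eventually (\<lambda>n. \<not> pos (f n) < pos (g n)) U" "eventually (\<lambda>n. \<not> pos (g n) < pos (f n)) U"
    "eventually (\<lambda>n. f n \<in> points) U" "eventually (\<lambda>n. g n \<in> points) U"
    using assms below_dichotomy by (auto simp: nonstandard_def)
  then show ?thesis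
  proof eventually_elim
    case (elim n)
    then have "pos (f n) = pos (g n)" by simp
    then show ?case using elim pos_inj by (simp add: points_iff)
  qed
qed

lemma below_asym: "below f g \<Longrightarrow> \<not> below g f"
  unfolding below_def by (rule eventually_not_U) (auto elim: eventually_mono)

lemma eventually_eq_not_below: "eventually (\<lambda>n. f n = g n) U \<Longrightarrow> \<not> below f g"
  unfolding below_def by (rule eventually_not_U) (auto elim: eventually_mono)

text \<open>The search ranges over all fractions of color \<open>i\<close>, which keeps it
  decidable; that its result is a point follows afterwards from the growth of its height. The
  endpoints \<open>l\<close> and \<open>u\<close> may be arbitrary fractions, such as those given by
  \<open>line\<close>.\<close>

lemma nonstandard_between:
  assumes l: "computable l" and u: "computable u" and lim: "filterlim (\<lambda>n. ht (l n)) at_top U"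
    and lu: "eventually (\<lambda>n. pos (l n) < pos (u n)) U" and i: "i \<le> N"
  shows "\<exists>f\<in>nonstandard. lim_col f = i \<and> below l f \<and> below f u"
proof -
  \<comment> \<open>The implication makes the search succeed, with a meaningless result, at the few
    arguments where the interval is empty.\<close>
  define f where "f n = (LEAST a. pos (l n) < pos (u n) \<longrightarrow> col a = i \<and> pos (l n) < pos a \<and> pos a < pos (u n))" for n
  have ex: "\<exists>a. pos (l n) < pos (u n) \<longrightarrow> col a = i \<and> pos (l n) < pos a \<and> pos a < pos (u n)" for n
    using pos_dense[OF i pos_nonneg] by blast
  have f: "computable f" unfolding f_def
    by (intro cintros ex computable_comp[OF l] computable_comp[OF u])
  have *: "eventually (\<lambda>n. col (f n) = i \<and> pos (l n) < pos (f n) \<and> pos (f n) < pos (u n)) U"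
    using lu
  proof eventually_elim
    case (elim n)
    then show ?case using LeastI_ex[OF ex[of n]] unfolding f_def[symmetric] by blast
  qed
  have "filterlim (\<lambda>n. ht (f n)) at_top U"
    unfolding filterlim_at_top
  proof
    fix q
    have "eventually (\<lambda>n. q \<le> ht (l n)) U" using lim by (simp add: filterlim_at_top)
    with * show "eventually (\<lambda>n. q \<le> ht (f n)) U" by eventually_elim (simp add: ht_le_iff)
  qed
  moreover from * have "eventually (\<lambda>n. col (f n) \<le> N) U" by eventually_elim (simp add: i)
  ultimately have "f \<in> nonstandard" using f eventually_points by (simp add: nonstandard_def)
  moreover have "lim_col f = i" using * by (auto intro!: lim_col_eq elim: eventually_mono)
  moreover have "below l f" "below f u" unfolding below_def using * by (auto elim: eventually_mono)
  ultimately show ?thesis by blast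
qed

lemma countable_nonstandard: "countable nonstandard"
proof -
  have "(\<lambda>f n. Some (f n :: nat)) ` nonstandard \<subseteq> {f. partial_computable f}"
    by (auto simp: nonstandard_def computable_def)
  then have "countable ((\<lambda>f n. Some (f n :: nat)) ` nonstandard)"
    by (rule countable_subset) (rule countable_partial_computable)
  moreover have "inj_on (\<lambda>f n. Some (f n :: nat)) nonstandard" by (auto simp: inj_on_def fun_eq_iff)
  ultimately show ?thesis by (rule countable_image_inj_on)
qed

text \<open>Colors are the finite orders themselves and not their indices, since \<open>k\<close>
  may repeat values. Elements above and below a given one are found by density, with
  \<open>line\<close> providing an outer endpoint.\<close>

lemma dense_colored_nonstandard:
  "dense_colored nonstandard below (\<lambda>f. finite_order (k (lim_col f))) {finite_order (k i) | i. i \<le> N}"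
  unfolding dense_colored_def
proof (intro conjI ballI impI)
  let ?col = "\<lambda>f. finite_order (k (lim_col f))"
  have comp: "computable f" if "f \<in> nonstandard" for f using that by (simp add: nonstandard_def)
  have lim: "filterlim (\<lambda>n. ht (f n)) at_top U" if "f \<in> nonstandard" for f using that by (simp add: nonstandard_def)
  have between: "\<exists>z\<in>nonstandard. ?col z = c \<and> below l z \<and> below z u"
    if "computable l" "computable u" "filterlim (\<lambda>n. ht (l n)) at_top U" "below l u"
      "c \<in> {finite_order (k i) | i. i \<le> N}" for l u c
    using that nonstandard_between[of l u] by (fastforce simp: below_def)
  show "countable nonstandard" by (rule countable_nonstandard)
  show "nonstandard \<noteq> {}"
  proof -
    have "\<exists>f\<in>nonstandard. lim_col f = 0 \<and> below line f \<and> below f (\<lambda>n. line (Suc n))"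
    proof (rule nonstandard_between)
      show "filterlim (\<lambda>n. ht (line n)) at_top U" unfolding ht_line by (intro filterlim_U) simp
      show "eventually (\<lambda>n. pos (line n) < pos (line (Suc n))) U"
        using pos_line by (intro always_eventually allI) (rule less_trans)
      show "computable line" "computable (\<lambda>n. line (Suc n))" by (intro cintros)+
    qed simp
    then show ?thesis by blast
  qed
  show "?col ` nonstandard \<subseteq> {finite_order (k i) | i. i \<le> N}" using lim_col(2) by blast
  show "\<not> below y x" if "below x y" for x y using that by (rule below_asym)
  show "below x y \<or> below y z" if "x \<in> nonstandard" "y \<in> nonstandard" "z \<in> nonstandard" "below x z" for x y z
  proof (rule disjCI)
    assume "\<not> below y z"
    then have "eventually (\<lambda>n. \<not> pos (y n) < pos (z n)) U" using below_dichotomy comp that by blast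
    with \<open>below x z\<close> show "below x y" unfolding below_def by eventually_elim simp
  qed
  show "?col x = ?col y" if "x \<in> nonstandard" "y \<in> nonstandard" "\<not> below x y" "\<not> below y x" for x y
  proof -
    have "eventually (\<lambda>n. col (x n) = lim_col y) U"
      using not_below_eq[OF that] lim_col(1)[OF that(2)] by eventually_elim simp
    then show ?thesis by (simp add: lim_col_eq)
  qed
  show "\<exists>z\<in>nonstandard. ?col z = c \<and> below x z \<and> below z y"
    if "c \<in> {finite_order (k i) | i. i \<le> N}" "x \<in> nonstandard" "y \<in> nonstandard" "below x y" for c x y
    using between comp lim that by blast
  show "\<exists>z\<in>nonstandard. ?col z = c \<and> below x z"
    if "c \<in> {finite_order (k i) | i. i \<le> N}" "x \<in> nonstandard" for c x
  proof -
    have "below x (\<lambda>n. line (Suc (ht (x n))))"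
      unfolding below_def using pos_less_Suc_ht pos_line(1) by (intro always_eventually allI) (rule less_trans)
    moreover have "computable (\<lambda>n. line (Suc (ht (x n))))" by (intro cintros comp that)
    ultimately show ?thesis
      using between[of x "\<lambda>n. line (Suc (ht (x n)))" c] comp[OF that(2)] lim[OF that(2)] that(1) by blast
  qed
  show "\<exists>z\<in>nonstandard. ?col z = c \<and> below z x"
    if "c \<in> {finite_order (k i) | i. i \<le> N}" "x \<in> nonstandard" for c x
  proof -
    have ev: "eventually (\<lambda>n. Suc q \<le> ht (x n)) U" for q using lim[OF that(2)] by (simp add: filterlim_at_top)
    \<comment> \<open>Positive height is required here because of truncated subtraction; it holds
      almost everywhere on \<open>C\<close>.\<close>
    have "below (\<lambda>n. line (ht (x n) - 1)) x"
      unfolding below_def using ev[of 0]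
    proof eventually_elim
      case (elim n)
      then show ?case using pos_line(2)[of "ht (x n) - 1"] of_nat_ht_le[of "x n"] by simp
    qed
    moreover have "filterlim (\<lambda>n. ht (line (ht (x n) - 1))) at_top U"
      unfolding filterlim_at_top ht_line
    proof
      show "eventually (\<lambda>n. q \<le> ht (x n) - 1) U" for q using ev[of q] by eventually_elim simp
    qed
    moreover have "computable (\<lambda>n. line (ht (x n) - 1))" by (intro cintros comp that)
    ultimately show ?thesis using between[of "\<lambda>n. line (ht (x n) - 1)" x c] comp[OF that(2)] that by blast
  qed
qed

section \<open>Representatives of the elements of the power\<close>

lemma eventually_in_power_functions:
  assumes "\<phi> \<in> power_functions C carrier"
  shows "\<exists>g. computable g \<and> eventually (\<lambda>n. \<phi> n = Some (g n)) U \<and> eventually (\<lambda>n. g n \<in> carrier) U"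
proof -
  obtain g where g: "computable g" "eventually (\<lambda>n. \<phi> n = Some (g n)) U"
    using total_representative[of \<phi>] assms by (auto simp: power_functions_def)
  from g(2) have "eventually (\<lambda>n. g n \<in> carrier) U"
  proof eventually_elim
    case (elim n)
    then show ?case using assms ranI[of \<phi> n] by (auto simp: power_functions_def)
  qed
  with g show ?thesis by blast
qed

text \<open>The code \<open>elt (f n) j\<close> contains the entry stage of \<open>f n\<close>,
  found by a search that diverges when \<open>f n\<close> is not a point or \<open>j\<close> is too
  large. The function is therefore partial, and its whole range lies in
  \<open>carrier\<close>.\<close>

lemma power_functions_elt:
  assumes f: "f \<in> nonstandard" and j: "j < k (lim_col f)"
  shows "\<exists>\<phi>\<in>power_functions C carrier. eventually (\<lambda>n. \<phi> n = Some (elt (f n) j)) U"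
proof -
  have comp: "computable f" using f by (simp add: nonstandard_def)
  define P where "P n s \<longleftrightarrow> (col (f n) \<le> N \<and> j < k (col (f n))) \<and> entered (f n) s" for n s
  define \<psi> where "\<psi> n = (if \<exists>s. P n s then Some (LEAST s. P n s) else None)" for n
  \<comment> \<open>Written in exactly the shape of the rule \<open>pair\<close>, applied
    twice.\<close>
  define \<phi> where "\<phi> n = Option.bind (Some (f n)) (\<lambda>a. Option.bind
      (Option.bind (\<psi> n) (\<lambda>s. Option.bind (Some j) (\<lambda>j. Some (pr s j)))) (\<lambda>b. Some (pr a b)))" for n
  have "partial_computable \<psi>"
    unfolding \<psi>_def P_def by (intro partial_computable_LEAST cintros computable_comp[OF comp])
  then have \<phi>: "partial_computable \<phi>"
    unfolding \<phi>_def using comp computable_const[of j]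
    by (intro partial_computable.pair) (simp_all add: computable_def)
  have \<psi>: "\<psi> n = (if f n \<in> points \<and> j < k (col (f n)) then Some (entry (f n)) else None)" for n
  proof -
    have "P n = (if col (f n) \<le> N \<and> j < k (col (f n)) then entered (f n) else (\<lambda>_. False))"
      by (auto simp: P_def fun_eq_iff)
    then show ?thesis by (auto simp: \<psi>_def points_iff entry_def)
  qed
  have \<phi>_eq: "\<phi> n = (if f n \<in> points \<and> j < k (col (f n)) then Some (elt (f n) j) else None)" for n
    by (simp add: \<phi>_def \<psi> elt_def)
  have "eventually (\<lambda>n. f n \<in> points) U" using f by (simp add: nonstandard_def)
  with lim_col(1)[OF f] have ev: "eventually (\<lambda>n. \<phi> n = Some (elt (f n) j)) U"
    by eventually_elim (simp add: \<phi>_eq j)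
  moreover have "ran \<phi> \<subseteq> carrier" by (auto simp: ran_def \<phi>_eq split: if_splits)
  moreover have "C \<subseteq>\<^sup>* dom \<phi>"
    unfolding dom_def almost_subset_iff using ev by (rule eventually_mono) simp
  ultimately show ?thesis using \<phi> by (auto simp: power_functions_def)
qed

lemma power_eq_iff:
  assumes "\<phi> \<in> power_functions C carrier" "\<psi> \<in> power_functions C carrier"
    and "eventually (\<lambda>n. \<phi> n = Some (p n)) U" "eventually (\<lambda>n. \<psi> n = Some (q n)) U"
  shows "(\<phi>, \<psi>) \<in> power_eq C carrier \<longleftrightarrow> eventually (\<lambda>n. p n = q n) U"
proof -
  have "eventually (\<lambda>n. (\<exists>u. \<phi> n = Some u \<and> \<psi> n = Some u) \<longleftrightarrow> p n = q n) U"
    using assms(3,4) by eventually_elim auto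
  from eventually_subst[OF this] show ?thesis
    using assms(1,2) by (simp add: power_eq_def almost_subset_iff)
qed

lemma power_less_iff:
  assumes "eventually (\<lambda>n. \<phi> n = Some (p n)) U" "eventually (\<lambda>n. \<psi> n = Some (q n)) U"
  shows "C \<subseteq>\<^sup>* {x. \<exists>u v. \<phi> x = Some u \<and> \<psi> x = Some v \<and> (u, v) \<in> rel} \<longleftrightarrow> eventually (\<lambda>n. (p n, q n) \<in> rel) U"
proof -
  have "eventually (\<lambda>n. (\<exists>u v. \<phi> n = Some u \<and> \<psi> n = Some v \<and> (u, v) \<in> rel) \<longleftrightarrow> (p n, q n) \<in> rel) U"
    using assms by eventually_elim auto
  from eventually_subst[OF this] show ?thesis by (simp only: almost_subset_iff)
qed

text \<open>Normal forms: constant functions match the summand \<omega> through \<open>rank\<close>,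
  and a non-standard block function with a fixed offset matches a point of the shuffle through
  \<theta>.\<close>

definition represents :: "((nat \<Rightarrow> nat) \<Rightarrow> rat) \<Rightarrow> (nat \<Rightarrow> nat) \<Rightarrow> nat + rat \<times> nat \<Rightarrow> bool" where
  "represents \<theta> p y \<longleftrightarrow>
     (\<exists>d\<in>carrier. p = (\<lambda>_. d) \<and> y = Inl (rank rel d)) \<or>
     (\<exists>f\<in>nonstandard. \<exists>j<k (lim_col f). p = (\<lambda>n. elt (f n) j) \<and> y = Inr (\<theta> f, j))"

lemma represents_standard: "d \<in> carrier \<Longrightarrow> represents \<theta> (\<lambda>_. d) (Inl (rank rel d))"
  by (auto simp: represents_def)

lemma represents_nonstandard:
  "f \<in> nonstandard \<Longrightarrow> j < k (lim_col f) \<Longrightarrow> represents \<theta> (\<lambda>n. elt (f n) j) (Inr (\<theta> f, j))"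
  by (auto simp: represents_def)

text \<open>The block of \<open>g n\<close> is either non-standard or constant almost everywhere on
  \<open>C\<close>. In both cases its size is eventually fixed, so the offset takes finitely many
  values and is eventually constant.\<close>

lemma represents_exists:
  assumes g: "computable g" "eventually (\<lambda>n. g n \<in> carrier) U"
  shows "\<exists>p y. eventually (\<lambda>n. g n = p n) U \<and> represents \<theta> p y"
proof -
  have "eventually (\<lambda>n. block (g n) \<in> points) U" using g(2) by (rule eventually_mono) (simp add: carrier_def)
  moreover have "computable (\<lambda>n. block (g n))" by (intro cintros g)
  ultimately consider "(\<lambda>n. block (g n)) \<in> nonstandard" | a where "a \<in> points" "eventually (\<lambda>n. block (g n) = a) U"
    using standard_or_nonstandard[of "\<lambda>n. block (g n)"] by blast
  moreover have offset: "computable (\<lambda>n. offset (g n))" by (intro cintros g)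
  ultimately show ?thesis
  proof cases
    case 1
    let ?f = "\<lambda>n. block (g n)"
    have "eventually (\<lambda>n. offset (g n) \<in> {..<k (lim_col ?f)}) U"
      using lim_col(1)[OF 1] g(2) by eventually_elim (auto simp: carrier_def)
    then obtain j where j: "j < k (lim_col ?f)" "eventually (\<lambda>n. offset (g n) = j) U"
      using eventually_constant[OF offset, of "{..<k (lim_col ?f)}"] by auto
    from j(2) g(2) have "eventually (\<lambda>n. g n = elt (?f n) j) U" by eventually_elim (auto simp: carrier_def)
    then show ?thesis using represents_nonstandard[OF 1 j(1)] by (intro exI[of _ "\<lambda>n. elt (?f n) j"]) blast
  next
    case 2
    have "eventually (\<lambda>n. offset (g n) \<in> {..<k (col a)}) U"
      using 2(2) g(2) by eventually_elim (auto simp: carrier_def)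
    then obtain j where j: "j < k (col a)" "eventually (\<lambda>n. offset (g n) = j) U"
      using eventually_constant[OF offset, of "{..<k (col a)}"] by auto
    from j(2) 2(2) g(2) have "eventually (\<lambda>n. g n = elt a j) U" by eventually_elim (auto simp: carrier_def)
    moreover have "elt a j \<in> carrier" using 2(1) j(1) by simp
    ultimately show ?thesis using represents_standard by (intro exI[of _ "\<lambda>_. elt a j"]) blast
  qed
qed

lemma standard_below_nonstandard:
  assumes "f \<in> nonstandard" "j < k (lim_col f)" "d \<in> carrier"
  shows "eventually (\<lambda>n. (d, elt (f n) j) \<in> rel) U"
proof -
  have "eventually (\<lambda>n. Suc (ht (block d)) \<le> ht (f n)) U" "eventually (\<lambda>n. f n \<in> points) U"
    using assms(1) by (auto simp: nonstandard_def filterlim_at_top)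
  with lim_col(1)[OF assms(1)] show ?thesis
  proof eventually_elim
    case (elim n)
    then have "pos (block d) < pos (f n)" using pos_less_Suc_ht[of "block d"] by (simp add: ht_le_iff)
    then show ?case using elim assms by (simp add: rel_def)
  qed
qed

lemma eventually_elt_in_carrier:
  assumes "f \<in> nonstandard" "j < k (lim_col f)"
  shows "eventually (\<lambda>n. elt (f n) j \<in> carrier) U"
proof -
  have "eventually (\<lambda>n. f n \<in> points) U" using assms(1) by (simp add: nonstandard_def)
  with lim_col(1)[OF assms(1)] show ?thesis by eventually_elim (simp add: assms(2))
qed

lemma nonstandard_rel_iff:
  assumes "f \<in> nonstandard" "j < k (lim_col f)" "g \<in> nonstandard" "i < k (lim_col g)"
  shows "eventually (\<lambda>n. (elt (f n) j, elt (g n) i) \<in> rel) U \<longleftrightarrow>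
    below f g \<or> eventually (\<lambda>n. f n = g n) U \<and> j < i"
proof -
  note pts = eventually_elt_in_carrier[OF assms(1,2)] eventually_elt_in_carrier[OF assms(3,4)]
  have iff: "eventually (\<lambda>n. (elt (f n) j, elt (g n) i) \<in> rel) U \<longleftrightarrow>
      eventually (\<lambda>n. pos (f n) < pos (g n) \<or> f n = g n \<and> j < i) U"
    by (rule eventually_subst) (use pts in \<open>eventually_elim, simp add: rel_def\<close>)
  show ?thesis
  proof
    assume *: "eventually (\<lambda>n. (elt (f n) j, elt (g n) i) \<in> rel) U"
    show "below f g \<or> eventually (\<lambda>n. f n = g n) U \<and> j < i"
    proof (cases "below f g")
      case False
      then have "eventually (\<lambda>n. \<not> pos (f n) < pos (g n)) U"
        using below_dichotomy assms by (auto simp: nonstandard_def)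
      with * have "eventually (\<lambda>n. f n = g n \<and> j < i) U" unfolding iff by eventually_elim blast
      then show ?thesis by (simp add: eventually_conj_iff)
    qed simp
  next
    assume "below f g \<or> eventually (\<lambda>n. f n = g n) U \<and> j < i"
    then show "eventually (\<lambda>n. (elt (f n) j, elt (g n) i) \<in> rel) U"
      unfolding iff below_def by (auto elim: eventually_mono)
  qed
qed

lemma rel_irrefl: "(x, x) \<notin> rel" and rel_asym: "(x, y) \<in> rel \<Longrightarrow> (y, x) \<notin> rel"
  by (auto simp: rel_def)

lemma power_isomorphic:
  "order_isomorphic (cohesive_power C (carrier, rel))
     (sum_order omega_order (shuffle {finite_order (k i) | i. i \<le> N}))"
proof -
  let ?X = "{finite_order (k i) | i. i \<le> N}" and ?F = "power_functions C carrier"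
  \<comment> \<open>The very coloring that \<open>shuffle\<close> selects; the back-and-forth
    argument is applied to it directly.\<close>
  define c where "c = (SOME c. dense_coloring ?X c)"
  have "?X = (\<lambda>i. finite_order (k i)) ` {..N}" by auto
  then have c: "dense_coloring ?X c" unfolding c_def using dense_coloring_exists by (metis someI_ex)
  obtain \<theta> where \<theta>: "\<theta> ` nonstandard = UNIV" "\<And>f. f \<in> nonstandard \<Longrightarrow> c (\<theta> f) = finite_order (k (lim_col f))"
    "\<And>f g. f \<in> nonstandard \<Longrightarrow> g \<in> nonstandard \<Longrightarrow> below f g \<longleftrightarrow> \<theta> f < \<theta> g"
    using dense_colored_iso_rat[OF dense_colored_nonstandard c] by blast
  have \<theta>_eq: "eventually (\<lambda>n. f n = g n) U \<longleftrightarrow> \<theta> f = \<theta> g" if "f \<in> nonstandard" "g \<in> nonstandard" for f g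
  proof
    assume ev: "eventually (\<lambda>n. f n = g n) U"
    then have "eventually (\<lambda>n. g n = f n) U" by (rule eventually_mono) simp
    with ev show "\<theta> f = \<theta> g" using eventually_eq_not_below \<theta>(3) that by (metis linorder_neqE)
  next
    assume "\<theta> f = \<theta> g"
    then show "eventually (\<lambda>n. f n = g n) U" using not_below_eq that \<theta>(3) by (metis less_irrefl)
  qed
  define B :: "(nat + rat \<times> nat) set" where "B = UNIV <+> (SIGMA q:UNIV. fst (c q))"
  define s where "s = snd (sum_order omega_order (shuffle ?X))"
  have sum: "sum_order omega_order (shuffle ?X) = (B, s)"
    by (simp add: omega_order_def shuffle_def replace_rationals_def c_def[symmetric] B_def s_def)
  have s_ll: "(Inl m, Inl n) \<in> s \<longleftrightarrow> m < n" for m n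
    by (auto simp: s_def omega_order_def shuffle_def replace_rationals_def)
  have s_lr: "(Inl m, Inr z) \<in> s \<longleftrightarrow> Inr z \<in> B" "(Inr z, Inl m) \<notin> s" for m z
    by (auto simp: s_def omega_order_def shuffle_def replace_rationals_def c_def[symmetric] B_def)
  have s_rr: "(Inr (q, j), Inr (r, i)) \<in> s \<longleftrightarrow> j \<in> fst (c q) \<and> i \<in> fst (c r) \<and> (q < r \<or> q = r \<and> (j, i) \<in> snd (c q))"
    for q j r i
    by (auto simp: s_def omega_order_def shuffle_def replace_rationals_def c_def[symmetric])
  have in_B: "y \<in> B" if "represents \<theta> p y" for p y
    using that \<theta>(2) by (auto simp: represents_def B_def finite_order_def)
  have rep_eq: "eventually (\<lambda>n. p n = q n) U \<longleftrightarrow> y = z" and rep_less: "eventually (\<lambda>n. (p n, q n) \<in> rel) U \<longleftrightarrow> (y, z) \<in> s"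
    if p: "represents \<theta> p y" and q: "represents \<theta> q z" for p q y z
  proof -
    \<comment> \<open>Standard elements lie strictly below non-standard ones, which excludes
      equality and the reverse order in the mixed cases.\<close>
    have no_eq: "\<not> eventually (\<lambda>n. d = elt (f n) j) U \<and> \<not> eventually (\<lambda>n. elt (f n) j = d) U \<and>
        \<not> eventually (\<lambda>n. (elt (f n) j, d) \<in> rel) U"
      if "d \<in> carrier" "f \<in> nonstandard" "j < k (lim_col f)" for d f j
    proof -
      have ev: "eventually (\<lambda>n. (d, elt (f n) j) \<in> rel) U"
        using standard_below_nonstandard[OF that(2,3,1)] .
      show ?thesis
        by (intro conjI eventually_not_U eventually_mono[OF ev]) (use rel_irrefl rel_asym in auto)
    qed
    have both: "(eventually (\<lambda>n. p n = q n) U \<longleftrightarrow> y = z) \<and> (eventually (\<lambda>n. (p n, q n) \<in> rel) U \<longleftrightarrow> (y, z) \<in> s)"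
      using p unfolding represents_def
    proof (elim disjE bexE exE conjE)
      fix d assume d: "d \<in> carrier" "p = (\<lambda>_. d)" "y = Inl (rank rel d)"
      show ?thesis
        using q unfolding represents_def
      proof (elim disjE bexE exE conjE)
        fix e assume e: "e \<in> carrier" "q = (\<lambda>_. e)" "z = Inl (rank rel e)"
        have "rank rel d = rank rel e \<longleftrightarrow> d = e" using rank_bij d e by (auto simp: bij_betw_def inj_on_def)
        then show ?thesis using d e rank_less_iff by (simp add: s_ll)
      next
        fix f j assume f: "f \<in> nonstandard" "j < k (lim_col f)" "q = (\<lambda>n. elt (f n) j)" "z = Inr (\<theta> f, j)"
        then show ?thesis using d no_eq standard_below_nonstandard in_B[OF q] by (simp add: s_lr)
      qed
    next
      fix f j assume f: "f \<in> nonstandard" "j < k (lim_col f)" "p = (\<lambda>n. elt (f n) j)" "y = Inr (\<theta> f, j)"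
      show ?thesis
        using q unfolding represents_def
      proof (elim disjE bexE exE conjE)
        fix e assume e: "e \<in> carrier" "q = (\<lambda>_. e)" "z = Inl (rank rel e)"
        then show ?thesis using f no_eq by (simp add: s_lr)
      next
        fix g i assume g: "g \<in> nonstandard" "i < k (lim_col g)" "q = (\<lambda>n. elt (g n) i)" "z = Inr (\<theta> g, i)"
        have elt_eq: "elt a j = elt b i \<longleftrightarrow> a = b \<and> j = i" for a b by (metis block_elt offset_elt)
        have "eventually (\<lambda>n. p n = q n) U \<longleftrightarrow> y = z"
          using f g by (simp add: elt_eq eventually_conj_iff \<theta>_eq)
        moreover have "j \<in> fst (c (\<theta> f))" "i \<in> fst (c (\<theta> g))"
          using f g by (simp_all add: \<theta>(2) finite_order_def)
        moreover have "(j, i) \<in> snd (c (\<theta> f)) \<longleftrightarrow> j < i" if "\<theta> f = \<theta> g"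
          using \<theta>(2)[OF g(1)] g(2) by (auto simp: that finite_order_def)
        ultimately show ?thesis
          using f g by (auto simp: nonstandard_rel_iff s_rr \<theta>_eq \<theta>(3))
      qed
    qed
    then show "eventually (\<lambda>n. p n = q n) U \<longleftrightarrow> y = z" "eventually (\<lambda>n. (p n, q n) \<in> rel) U \<longleftrightarrow> (y, z) \<in> s"
      by blast+
  qed
  define R where "R \<phi> y \<longleftrightarrow> (\<exists>p. eventually (\<lambda>n. \<phi> n = Some (p n)) U \<and> represents \<theta> p y)" for \<phi> :: "nat \<rightharpoonup> nat" and y
  show ?thesis
    unfolding sum
  proof (rule cohesive_power_isoI[where R = R])
    show "\<exists>y\<in>B. R \<phi> y" if \<phi>: "\<phi> \<in> ?F" for \<phi>
    proof -
      obtain g where g: "computable g" "eventually (\<lambda>n. \<phi> n = Some (g n)) U" "eventually (\<lambda>n. g n \<in> carrier) U"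
        using eventually_in_power_functions[OF \<phi>] by blast
      obtain p y where p: "eventually (\<lambda>n. g n = p n) U" "represents \<theta> p y"
        using represents_exists[OF g(1,3)] by blast
      from g(2) p(1) have "eventually (\<lambda>n. \<phi> n = Some (p n)) U" by eventually_elim simp
      then show ?thesis using p(2) in_B unfolding R_def by blast
    qed
    show "\<exists>\<phi>\<in>?F. R \<phi> y" if "y \<in> B" for y
    proof (cases y)
      case (Inl m)
      obtain d where d: "d \<in> carrier" "rank rel d = m" using rank_bij by (metis UNIV_I bij_betw_iff_bijections)
      have "(\<lambda>_. Some d) \<in> ?F"
        using d computable_const[of d] by (simp add: power_functions_def computable_def almost_subset_def dom_def ran_def)
      moreover have "R (\<lambda>_. Some d) y"
        unfolding R_def using represents_standard[OF d(1)] d(2) Inl by (intro exI[of _ "\<lambda>_. d"]) auto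
      ultimately show ?thesis by blast
    next
      case (Inr z)
      obtain q j where z: "z = (q, j)" by (cases z)
      obtain f where f: "f \<in> nonstandard" "\<theta> f = q" using \<theta>(1) by (metis UNIV_I imageE)
      then have "j < k (lim_col f)" using that \<theta>(2)[OF f(1)] by (auto simp: Inr z B_def finite_order_def)
      then obtain \<phi> where "\<phi> \<in> ?F" "eventually (\<lambda>n. \<phi> n = Some (elt (f n) j)) U"
        using power_functions_elt[OF f(1)] by blast
      moreover have "represents \<theta> (\<lambda>n. elt (f n) j) y"
        using represents_nonstandard[OF f(1) \<open>j < k (lim_col f)\<close>, of \<theta>] f(2) Inr z by simp
      ultimately show ?thesis unfolding R_def by (intro bexI[of _ \<phi>] exI[of _ "\<lambda>n. elt (f n) j"]) auto
    qed
    fix \<phi> \<psi> y z assume "\<phi> \<in> ?F" "\<psi> \<in> ?F" "R \<phi> y" "R \<psi> z"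
    then obtain p q where pq: "eventually (\<lambda>n. \<phi> n = Some (p n)) U" "represents \<theta> p y"
      "eventually (\<lambda>n. \<psi> n = Some (q n)) U" "represents \<theta> q z" unfolding R_def by blast
    show "(\<phi>, \<psi>) \<in> power_eq C carrier \<longleftrightarrow> y = z"
      using power_eq_iff[OF \<open>\<phi> \<in> ?F\<close> \<open>\<psi> \<in> ?F\<close> pq(1,3)] rep_eq[OF pq(2,4)] by blast
    show "C \<subseteq>\<^sup>* {x. \<exists>u v. \<phi> x = Some u \<and> \<psi> x = Some v \<and> (u, v) \<in> rel} \<longleftrightarrow> (y, z) \<in> s"
      using power_less_iff[OF pq(1,3)] rep_less[OF pq(2,4)] by blast
  qed
qed

end

theorem theorem6p2:
  fixes N :: nat and k :: "nat \<Rightarrow> nat" and C :: "nat set"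
  assumes "\<forall>i\<le>N. k i \<noteq> 0"
    and "cohesive C"
    and "ce (- C)"
  shows "\<exists>M. computable_linear_order M \<and> order_isomorphic M omega_order \<and>
    order_isomorphic (cohesive_power C M)
      (sum_order omega_order (shuffle {finite_order (k i) | i. i \<le> N}))"
proof -
  obtain Cs where "cohesive_set C Cs" using cohesive_set_exists[OF assms(2,3)] ..
  then interpret block_order C Cs N k
    using assms(1) by (simp add: block_order_def block_order_axioms_def)
  show ?thesis using computable_linear_order isomorphic_omega power_isomorphic by blast
qed

end
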